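(* Let $c\ge 0$ be a constant. For every $c\log n$-random labeled graph $G$ on $n$ nodes, in model IA $\wedge$ $\alpha$ (nodes do not know their neighbours, port assignment fixed arbitrarily, no relabeling), there is a shortest path routing scheme in which each local routing function is stored in $(n/2)\log n\,(1+o(1))$ bits; hence the complete scheme uses at most $(n^2/2)\log n\,(1+o(1))$ bits.
   Context: $C(x\mid y)$ is Kolmogorov complexity w.r.t. a fixed universal Turing machine; $\log$ is base 2. A labeled graph $G$ on $V=\{1,\dots,n\}$ is encoded by $E(G)\in\{0,1\}^{n(n-1)/2}$ (bit $i$ indicates the $i$-th possible edge in lexicographic order); with $\mathcal G$ the set of all labeled graphs on $V$, $G$ is $\delta(n)$-random if $C(E(G)\mid n,\delta,\mathcal G)\ge n(n-1)/2-\delta(n)$. Edges at a node $v$ are attached to ports $1,\dots,\deg(v)$ by a port assignment. A routing scheme consists of a local routing function at each node $u$ returning, for each destination label $v\ne u$, a port of $u$; a shortest path routing scheme always yields shortest paths. Model IA: nodes do not know their neighbours' labels and the port assignment is fixed (cannot be changed). Model $\alpha$: nodes keep their labels $1,\dots,n$. *)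

theory Defs
  imports Complex_Main "HOL-Library.Nat_Bijection"
begin

datatype instr = Inc nat | Dec nat nat

fun rm_step :: "instr list \<Rightarrow> nat \<times> (nat \<Rightarrow> nat) \<Rightarrow> nat \<times> (nat \<Rightarrow> nat)" where
  "rm_step P (pc, R) =
     (if pc < length P then
        (case P ! pc of
           Inc r \<Rightarrow> (Suc pc, R(r := Suc (R r)))
         | Dec r j \<Rightarrow> (if R r = 0 then (j, R) else (Suc pc, R(r := R r - 1))))
      else (pc, R))"

definition rm_run :: "instr list \<Rightarrow> nat \<Rightarrow> nat \<times> (nat \<Rightarrow> nat) \<Rightarrow> nat \<times> (nat \<Rightarrow> nat)" where
  "rm_run P t c = (rm_step P ^^ t) c"

definition rm_init :: "nat \<Rightarrow> nat \<Rightarrow> nat \<times> (nat \<Rightarrow> nat)" where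
  "rm_init a b = (0, (\<lambda>_. 0)(1 := a, 2 := b))"

definition rm_computes :: "instr list \<Rightarrow> (nat \<Rightarrow> nat \<Rightarrow> nat option) \<Rightarrow> bool" where
  "rm_computes P f \<longleftrightarrow>
     (\<forall>a b z. f a b = Some z \<longleftrightarrow>
        (\<exists>t. length P \<le> fst (rm_run P t (rm_init a b)) \<and> snd (rm_run P t (rm_init a b)) 0 = z))"

fun nat_of_bits :: "bool list \<Rightarrow> nat" where
  "nat_of_bits [] = 0"
| "nat_of_bits (b # bs) = Suc (2 * nat_of_bits bs + (if b then 1 else 0))"

fun bits_of_nat :: "nat \<Rightarrow> bool list" where
  "bits_of_nat 0 = []"
| "bits_of_nat (Suc n) = odd n # bits_of_nat (n div 2)"

definition computable :: "(bool list \<Rightarrow> bool list \<Rightarrow> bool list option) \<Rightarrow> bool" where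
  "computable \<phi> \<longleftrightarrow>
     (\<exists>P. rm_computes P (\<lambda>a b. map_option nat_of_bits (\<phi> (bits_of_nat a) (bits_of_nat b))))"

text \<open>\<open>U p y\<close>: output of machine U on program p with auxiliary input y.\<close>
definition KC :: "(bool list \<Rightarrow> bool list \<Rightarrow> bool list option) \<Rightarrow> bool list \<Rightarrow> bool list \<Rightarrow> nat" where
  "KC U x y = (LEAST k. \<exists>p. length p = k \<and> U p y = Some x)"

definition universal :: "(bool list \<Rightarrow> bool list \<Rightarrow> bool list option) \<Rightarrow> bool" where
  "universal U \<longleftrightarrow> computable U \<and>
     (\<forall>\<psi>. computable \<psi> \<longrightarrow> (\<exists>c. \<forall>x y p. \<psi> p y = Some x \<longrightarrow> KC U x y \<le> length p + c))"

definition graph_on :: "nat \<Rightarrow> (nat \<Rightarrow> nat \<Rightarrow> bool) \<Rightarrow> bool" where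
  "graph_on n adj \<longleftrightarrow>
     (\<forall>u v. adj u v \<longrightarrow> u \<in> {1..n} \<and> v \<in> {1..n} \<and> u \<noteq> v) \<and> (\<forall>u v. adj u v = adj v u)"

definition edge_code :: "nat \<Rightarrow> (nat \<Rightarrow> nat \<Rightarrow> bool) \<Rightarrow> bool list" where
  "edge_code n adj = concat (map (\<lambda>i. map (\<lambda>j. adj i j) [Suc i..<Suc n]) [1..<Suc n])"

text \<open>delta-random: C(E(G) | n, delta, set of graphs) \<ge> n(n-1)/2 - delta; the
conditional information is (an encoding of) n.\<close>
definition random_graph ::
  "(bool list \<Rightarrow> bool list \<Rightarrow> bool list option) \<Rightarrow> nat \<Rightarrow> real \<Rightarrow> (nat \<Rightarrow> nat \<Rightarrow> bool) \<Rightarrow> bool" where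
  "random_graph U n \<delta> adj \<longleftrightarrow> graph_on n adj \<and>
     real (KC U (edge_code n adj) (bits_of_nat n)) \<ge> real (n * (n - 1) div 2) - \<delta>"

definition deg :: "(nat \<Rightarrow> nat \<Rightarrow> bool) \<Rightarrow> nat \<Rightarrow> nat" where
  "deg adj u = card {w. adj u w}"

definition port_assignment :: "nat \<Rightarrow> (nat \<Rightarrow> nat \<Rightarrow> bool) \<Rightarrow> (nat \<Rightarrow> nat \<Rightarrow> nat) \<Rightarrow> bool" where
  "port_assignment n adj port \<longleftrightarrow>
     (\<forall>u\<in>{1..n}. bij_betw (port u) {w. adj u w} {1..deg adj u})"

definition nbr :: "(nat \<Rightarrow> nat \<Rightarrow> bool) \<Rightarrow> (nat \<Rightarrow> nat \<Rightarrow> nat) \<Rightarrow> nat \<Rightarrow> nat \<Rightarrow> nat" where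
  "nbr adj port u k = (THE w. adj u w \<and> port u w = k)"

definition is_walk :: "(nat \<Rightarrow> nat \<Rightarrow> bool) \<Rightarrow> nat list \<Rightarrow> bool" where
  "is_walk adj xs \<longleftrightarrow> xs \<noteq> [] \<and> (\<forall>i. Suc i < length xs \<longrightarrow> adj (xs ! i) (xs ! Suc i))"

definition reachable :: "(nat \<Rightarrow> nat \<Rightarrow> bool) \<Rightarrow> nat \<Rightarrow> nat \<Rightarrow> bool" where
  "reachable adj u v \<longleftrightarrow> (\<exists>xs. is_walk adj xs \<and> hd xs = u \<and> last xs = v)"

definition gdist :: "(nat \<Rightarrow> nat \<Rightarrow> bool) \<Rightarrow> nat \<Rightarrow> nat \<Rightarrow> nat" where
  "gdist adj u v = (LEAST k. \<exists>xs. is_walk adj xs \<and> length xs = Suc k \<and> hd xs = u \<and> last xs = v)"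

fun route :: "(nat \<Rightarrow> nat \<Rightarrow> bool) \<Rightarrow> (nat \<Rightarrow> nat \<Rightarrow> nat) \<Rightarrow> (nat \<Rightarrow> nat \<Rightarrow> nat)
              \<Rightarrow> nat \<Rightarrow> nat \<Rightarrow> nat \<Rightarrow> nat" where
  "route adj port R u v 0 = u"
| "route adj port R u v (Suc k) =
     (let x = route adj port R u v k in if x = v then v else nbr adj port x (R x v))"

definition shortest_path_scheme ::
  "nat \<Rightarrow> (nat \<Rightarrow> nat \<Rightarrow> bool) \<Rightarrow> (nat \<Rightarrow> nat \<Rightarrow> nat) \<Rightarrow> (nat \<Rightarrow> nat \<Rightarrow> nat) \<Rightarrow> bool" where
  "shortest_path_scheme n adj port R \<longleftrightarrow>
     (\<forall>u\<in>{1..n}. \<forall>v\<in>{1..n}. u \<noteq> v \<and> reachable adj u v \<longrightarrow>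
        R u v \<in> {1..deg adj u} \<and>
        route adj port R u v (gdist adj u v) = v \<and>
        (\<forall>k < gdist adj u v. route adj port R u v k \<noteq> v \<and>
             adj (route adj port R u v k) (route adj port R u v (Suc k))))"

text \<open>Local routing function of u as a table (ports for destinations 1..n, v \<noteq> u),
and its storage size: Kolmogorov complexity given n and the node's label u.\<close>
definition table_code :: "nat \<Rightarrow> (nat \<Rightarrow> nat \<Rightarrow> nat) \<Rightarrow> nat \<Rightarrow> bool list" where
  "table_code n R u = bits_of_nat (list_encode (map (R u) (filter (\<lambda>v. v \<noteq> u) [1..<Suc n])))"

definition local_size ::
  "(bool list \<Rightarrow> bool list \<Rightarrow> bool list option) \<Rightarrow> nat \<Rightarrow> (nat \<Rightarrow> nat \<Rightarrow> nat) \<Rightarrow> nat \<Rightarrow> nat" where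
  "local_size U n R u = KC U (table_code n R u) (bits_of_nat (prod_encode (n, u)))"

end

(*
  A c log n-random graph has two properties, because the graphs violating either of them form a
  decidable set so small that the index in its enumeration is too short a description of the graph:
  every degree is at most n/2 + n/q for each fixed q (exponential moments), and any two nodes have a
  common neighbour among the first M = O(log n) nodes (each such node fails with probability 3/4,
  independently). So node u sends directly to its neighbours, and to a non-neighbour v through a
  common neighbour w <= M. The table of u is then determined by the ports of the neighbours in
  increasing order of label, deg(u) log n bits, and for every v by a number at most M, telling
  whether v is a neighbour and otherwise the rank of w; these numbers take O(n log log n) bits.

  Upper bounds on KC only need decoders running on register machines. These are obtained by
  compiling primitive recursive terms.
*)
theory Submission
  imports Defs "HOL-Real_Asymp.Real_Asymp"
begin

subsection \<open>Register machine programs with loops\<close>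

text \<open>A decoder sees only n (or n and u) besides its program, so constants such as q and K
  must be built into the program, and the additive constant of the complexity bound depends on them.
  Hence each \<epsilon> > 0 yields only a statement for all large n, with its own threshold. The
  theorem wants a single null sequence f valid for every n: f takes, for each n, nearly the least
  admissible slack, and a crude table listing every destination shows that this slack is finite for
  small n. The leading term (n/2) log n is paid for explicit ports alone. A reference of log n bits
  for each of the roughly n/2 non-neighbours would double it. This is why the intermediate node has
  to lie among O(log n) candidates. Being atypical must save more than c log n + O(1) bits. For
  degrees the saving is linear in n, so every fixed q works; for common neighbours it is only
  logarithmic, so the number of candidates must be tuned to c.\<close>

datatype com = SKIP | INC nat | SEQ com com | LOOP nat com

text \<open>The machine's decrement at zero serves as the loop test, so each pass of \<open>LOOP r c\<close> starts by decrementing \<open>r\<close>.\<close>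
inductive big_step :: "com \<Rightarrow> (nat \<Rightarrow> nat) \<Rightarrow> (nat \<Rightarrow> nat) \<Rightarrow> bool" where
  Skip: "big_step SKIP s s"
| Inc: "big_step (INC r) s (s(r := Suc (s r)))"
| Seq: "big_step c s s' \<Longrightarrow> big_step d s' s'' \<Longrightarrow> big_step (SEQ c d) s s''"
| Loop0: "s r = 0 \<Longrightarrow> big_step (LOOP r c) s s"
| LoopS: "s r = Suc k \<Longrightarrow> big_step c (s(r := k)) s' \<Longrightarrow> big_step (LOOP r c) s' s'' \<Longrightarrow>
    big_step (LOOP r c) s s''"

primrec regs :: "com \<Rightarrow> nat set" where
  "regs SKIP = {}"
| "regs (INC r) = {r}"
| "regs (SEQ c d) = regs c \<union> regs d"
| "regs (LOOP r c) = insert r (regs c)"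

primrec code_size :: "com \<Rightarrow> nat" where
  "code_size SKIP = 0"
| "code_size (INC r) = 1"
| "code_size (SEQ c d) = code_size c + code_size d"
| "code_size (LOOP r c) = code_size c + 2"

text \<open>Register \<open>z\<close> is kept at zero, so that \<open>Dec z p\<close> is an unconditional jump to \<open>p\<close>.\<close>
primrec compile :: "nat \<Rightarrow> com \<Rightarrow> nat \<Rightarrow> instr list" where
  "compile z SKIP p = []"
| "compile z (INC r) p = [Inc r]"
| "compile z (SEQ c d) p = compile z c p @ compile z d (p + code_size c)"
| "compile z (LOOP r c) p = Dec r (p + code_size c + 2) # compile z c (Suc p) @ [Dec z p]"

lemma length_compile [simp]: "length (compile z c p) = code_size c"
  by (induction c arbitrary: p) auto

lemma rm_run_0 [simp]: "rm_run P 0 x = x"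
  by (simp add: rm_run_def)

lemma rm_run_Suc: "rm_run P (Suc t) x = rm_run P t (rm_step P x)"
  by (simp add: rm_run_def funpow_swap1)

lemma rm_run_add: "rm_run P (t + t') x = rm_run P t' (rm_run P t x)"
  unfolding rm_run_def by (subst add.commute) (simp add: funpow_add)

lemma big_step_zero_register:
  "big_step c s s' \<Longrightarrow> z \<notin> regs c \<Longrightarrow> s z = 0 \<Longrightarrow> s' z = 0"
  by (induction rule: big_step.induct) auto

text \<open>Jump targets are absolute, so correctness is claimed for code placed at
  \<open>length A\<close> between arbitrary instructions: in the induction each subcommand has its
  siblings as surroundings.\<close>

lemma compile_correct:
  assumes "big_step c s s'" "z \<notin> regs c" "s z = 0"
  shows "\<exists>t. rm_run (A @ compile z c (length A) @ B) t (length A, s) = (length A + code_size c, s')"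
  using assms
proof (induction arbitrary: A B rule: big_step.induct)
  case (Skip s)
  show ?case by (rule exI[of _ 0]) simp
next
  case (Inc r s)
  show ?case by (rule exI[of _ 1]) (simp add: rm_run_Suc nth_append fun_eq_iff)
next
  case (Seq c s s' d s'')
  have z: "s' z = 0"
    using Seq.hyps(1) Seq.prems big_step_zero_register by auto
  obtain t where t: "rm_run (A @ compile z c (length A) @ compile z d (length A + code_size c) @ B) t
      (length A, s) = (length A + code_size c, s')"
    using Seq.IH(1)[of A "compile z d (length A + code_size c) @ B"] Seq.prems by auto
  obtain t' where t': "rm_run (A @ compile z c (length A) @ compile z d (length A + code_size c) @ B) t'
      (length A + code_size c, s') = (length A + code_size c + code_size d, s'')"
    using Seq.IH(2)[of "A @ compile z c (length A)" B] Seq.prems z by auto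
  show ?case
    by (rule exI[of _ "t + t'"]) (simp add: rm_run_add t t')
next
  case (Loop0 s r c)
  then show ?case by (intro exI[of _ 1]) (simp add: rm_run_Suc nth_append)
next
  case (LoopS s r k c s' s'')
  let ?e = "length A + code_size c + 2"
  let ?P = "A @ compile z (LOOP r c) (length A) @ B"
  have z: "s' z = 0"
    using LoopS.hyps LoopS.prems big_step_zero_register[OF LoopS.hyps(2), of z] by auto
  \<comment> \<open>The test and the jump back are moved into the surroundings, which leaves the
    bare body for the induction hypothesis.\<close>
  obtain t where t: "rm_run ?P t (Suc (length A), s(r := k)) = (Suc (length A + code_size c), s')"
    using LoopS.IH(1)[of "A @ [Dec r ?e]" "[Dec z (length A)] @ B"] LoopS.prems
    by (auto simp: fun_upd_def)
  obtain t' where t': "rm_run ?P t' (length A, s') = (length A + code_size (LOOP r c), s'')"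
    using LoopS.IH(2)[of A B] LoopS.prems z by (auto simp: fun_upd_def)
  have step1: "rm_step ?P (length A, s) = (Suc (length A), s(r := k))"
    using LoopS.hyps by (simp add: nth_append)
  have step2: "rm_step ?P (Suc (length A + code_size c), s') = (length A, s')"
    using z by (simp add: nth_append)
  have "rm_run ?P (Suc (t + Suc t')) (length A, s) = (length A + code_size (LOOP r c), s'')"
    by (simp only: rm_run_Suc rm_run_add step1 t step2 t')
  then show ?case by blast
qed

lemma rm_step_halted: "length P \<le> fst x \<Longrightarrow> rm_step P x = x"
  by (cases x) auto

lemma rm_run_halted: "length P \<le> fst x \<Longrightarrow> rm_run P t x = x"
  by (induction t) (auto simp: rm_run_Suc rm_step_halted)

text \<open>\<open>rm_computes\<close> is an equivalence over all halting times. A halted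
  configuration is a fixed point, so two halting times give the same output and one halting run per
  input suffices.\<close>

lemma rm_computes_total:
  assumes "\<And>a b. \<exists>t. length P \<le> fst (rm_run P t (rm_init a b)) \<and> snd (rm_run P t (rm_init a b)) 0 = f a b"
  shows "rm_computes P (\<lambda>a b. Some (f a b))"
proof -
  have unique: "snd (rm_run P t x) 0 = snd (rm_run P t' x) 0"
    if "length P \<le> fst (rm_run P t x)" "length P \<le> fst (rm_run P t' x)" for t t' x
  proof -
    have "rm_run P (t + t') x = rm_run P t x" "rm_run P (t' + t) x = rm_run P t' x"
      using that by (simp_all only: rm_run_add rm_run_halted)
    then show ?thesis by (simp add: add.commute)
  qed
  show ?thesis
    unfolding rm_computes_def using assms unique by (metis option.inject)
qed

subsection \<open>Primitive recursive functions\<close>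

datatype tm = Var nat | Zero | Succ tm | Rec tm tm tm

text \<open>De Bruijn indices: \<open>Rec n a b\<close> binds index 0 (step) and index 1 (accumulator) in \<open>b\<close>.\<close>
primrec eval :: "tm \<Rightarrow> (nat \<Rightarrow> nat) \<Rightarrow> nat" where
  "eval (Var i) e = e i"
| "eval Zero e = 0"
| "eval (Succ t) e = Suc (eval t e)"
| "eval (Rec n a b) e =
     rec_nat (eval a e) (\<lambda>i acc. eval b (case_nat i (case_nat acc e))) (eval n e)"

text \<open>Variable \<open>i\<close> lives in register \<open>\<rho> i < d\<close>, the result goes to register \<open>d\<close>, and the registers
  above \<open>d\<close> are scratch space with arbitrary contents.\<close>
primrec to_com :: "tm \<Rightarrow> (nat \<Rightarrow> nat) \<Rightarrow> nat \<Rightarrow> com" where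
  "to_com (Var i) \<rho> d =
     SEQ (LOOP d SKIP) (SEQ (LOOP (Suc d) SKIP)
       (SEQ (LOOP (\<rho> i) (SEQ (INC d) (INC (Suc d)))) (LOOP (Suc d) (INC (\<rho> i)))))"
| "to_com Zero \<rho> d = LOOP d SKIP"
| "to_com (Succ t) \<rho> d = SEQ (to_com t \<rho> d) (INC d)"
| "to_com (Rec n a b) \<rho> d =
     SEQ (to_com n \<rho> d) (SEQ (to_com a \<rho> (d + 1)) (SEQ (LOOP (d + 2) SKIP) (SEQ
       (LOOP d (SEQ (to_com b (case_nat (d + 2) (case_nat (d + 1) \<rho>)) (d + 3))
                 (SEQ (LOOP (d + 1) SKIP) (SEQ (LOOP (d + 3) (INC (d + 1))) (INC (d + 2))))))
       (LOOP (d + 1) (INC d)))))"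

lemma big_step_clear: "big_step (LOOP r SKIP) s (s(r := 0))"
proof (induction "s r" arbitrary: s)
  case 0
  then show ?case using Loop0[of s r] by (simp add: fun_upd_idem)
next
  case (Suc k)
  show ?case
    using LoopS[of s r k SKIP "s(r := k)" "s(r := 0)"] Suc(1)[of "s(r := k)"] Suc(2) Skip
    by simp
qed

lemma big_step_move: "r \<noteq> q \<Longrightarrow> big_step (LOOP r (INC q)) s (s(r := 0, q := s q + s r))"
proof (induction "s r" arbitrary: s)
  case 0
  then show ?case using Loop0[of s r] by (simp add: fun_upd_idem)
next
  case (Suc k)
  let ?s = "s(r := k, q := Suc (s q))"
  have "big_step (INC q) (s(r := k)) ?s"
    using Inc[of q "s(r := k)"] Suc(3) by simp
  moreover have "big_step (LOOP r (INC q)) ?s (?s(r := 0, q := ?s q + ?s r))"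
    using Suc by (metis fun_upd_other fun_upd_same)
  moreover have "?s(r := 0, q := ?s q + ?s r) = s(r := 0, q := s q + s r)"
    using Suc(2,3) by (auto simp: fun_eq_iff simp flip: Suc(2))
  ultimately show ?case using LoopS Suc(2) by metis
qed

text \<open>Moving empties the source. Filling two registers at once makes copying possible: one of
  them is moved back afterwards.\<close>

lemma big_step_move2:
  assumes "r \<noteq> q" "r \<noteq> q'" "q \<noteq> q'"
  shows "big_step (LOOP r (SEQ (INC q) (INC q'))) s (s(r := 0, q := s q + s r, q' := s q' + s r))"
proof (induction "s r" arbitrary: s)
  case 0
  then show ?case using Loop0[of s r] by (simp add: fun_upd_idem)
next
  case (Suc k)
  let ?s = "s(r := k, q := Suc (s q), q' := Suc (s q'))"
  have "big_step (SEQ (INC q) (INC q')) (s(r := k)) ?s"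
    using Seq[OF Inc[of q "s(r := k)"] Inc[of q']] assms by simp
  moreover have "big_step (LOOP r (SEQ (INC q) (INC q'))) ?s
      (?s(r := 0, q := ?s q + ?s r, q' := ?s q' + ?s r))"
    using Suc assms by (metis fun_upd_other fun_upd_same)
  moreover have "?s(r := 0, q := ?s q + ?s r, q' := ?s q' + ?s r) =
      s(r := 0, q := s q + s r, q' := s q' + s r)"
    using assms by (auto simp: fun_eq_iff simp flip: Suc(2))
  ultimately show ?case using LoopS Suc(2) by metis
qed

text \<open>Preservation of all registers below \<open>d\<close> lets subterms be evaluated one
  after the other with growing \<open>d\<close>. Nothing is assumed about the registers from
  \<open>d\<close> on, because loop bodies are re-entered with dirty scratch registers.\<close>

lemma to_com_correct:
  assumes "\<forall>i. \<rho> i < d"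
  shows "\<exists>s'. big_step (to_com t \<rho> d) s s' \<and> s' d = eval t (\<lambda>i. s (\<rho> i)) \<and> (\<forall>r<d. s' r = s r)"
  using assms
proof (induction t arbitrary: \<rho> d s)
  case (Var i)
  let ?s1 = "s(d := 0)" let ?s2 = "?s1(Suc d := 0)"
  let ?s3 = "?s2(\<rho> i := 0, d := ?s2 d + ?s2 (\<rho> i), Suc d := ?s2 (Suc d) + ?s2 (\<rho> i))"
  let ?s4 = "?s3(Suc d := 0, \<rho> i := ?s3 (\<rho> i) + ?s3 (Suc d))"
  have i: "\<rho> i < d" using Var by simp
  have "big_step (to_com (Var i) \<rho> d) s ?s4"
    unfolding to_com.simps
    using i by (intro Seq[OF big_step_clear Seq[OF big_step_clear Seq[OF big_step_move2 big_step_move]]]) auto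
  then show ?case by (rule exI[of _ ?s4, OF conjI]) (use i in auto)
next
  case Zero
  show ?case using big_step_clear[of d s] by (auto simp: fun_upd_def)
next
  case (Succ t)
  obtain s' where s': "big_step (to_com t \<rho> d) s s'" "s' d = eval t (\<lambda>i. s (\<rho> i))" "\<forall>r<d. s' r = s r"
    using Succ.IH[OF Succ.prems] by blast
  have "big_step (to_com (Succ t) \<rho> d) s (s'(d := Suc (s' d)))"
    unfolding to_com.simps by (rule Seq[OF s'(1) Inc])
  then show ?case
    by (rule exI[of _ "s'(d := Suc (s' d))", OF conjI]) (use s' in auto)
next
  case (Rec n a b)
  define e where "e = (\<lambda>i. s (\<rho> i))"
  define f where "f = (\<lambda>i acc. eval b (case_nat i (case_nat acc e)))"
  define \<rho>' where "\<rho>' = case_nat (d + 2) (case_nat (d + 1) \<rho>)"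
  let ?body = "SEQ (to_com b \<rho>' (d + 3))
                 (SEQ (LOOP (d + 1) SKIP) (SEQ (LOOP (d + 3) (INC (d + 1))) (INC (d + 2))))"
  obtain s1 where s1: "big_step (to_com n \<rho> d) s s1" "s1 d = eval n e" "\<forall>r<d. s1 r = s r"
    using Rec.IH(1)[OF Rec.prems] unfolding e_def by blast
  have e1: "(\<lambda>i. s1 (\<rho> i)) = e" using s1(3) Rec.prems by (auto simp: e_def fun_eq_iff)
  have "\<forall>i. \<rho> i < d + 1" using Rec.prems by (simp add: less_SucI)
  then obtain s2 where s2: "big_step (to_com a \<rho> (d + 1)) s1 s2" "s2 (d + 1) = eval a e"
      "\<forall>r<d + 1. s2 r = s1 r"
    using Rec.IH(2)[of \<rho> "d + 1" s1] unfolding e1 by blast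
  let ?s3 = "s2(d + 2 := 0)"
  \<comment> \<open>Loop invariant: \<open>d\<close> holds the number \<open>k\<close> of remaining
    passes, \<open>d + 2\<close> the index \<open>j\<close>, \<open>d + 1\<close> the accumulator
    after \<open>j\<close> passes.\<close>
  have loop: "\<exists>s'. big_step (LOOP d ?body) s0 s' \<and> s' d = 0 \<and>
      s' (d + 1) = rec_nat (eval a e) f (j + k) \<and> (\<forall>r<d. s' r = s r)"
    if "s0 d = k" "s0 (d + 2) = j" "s0 (d + 1) = rec_nat (eval a e) f j" "\<forall>r<d. s0 r = s r" for s0 j k
    using that
  proof (induction k arbitrary: s0 j)
    case 0
    then show ?case by (intro exI[of _ s0]) (auto intro: Loop0)
  next
    case (Suc k)
    let ?t0 = "s0(d := k)"
    have "\<forall>i. \<rho>' i < d + 3"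
      using Rec.prems by (auto simp: \<rho>'_def split: nat.split intro: less_trans)
    then obtain t1 where t1: "big_step (to_com b \<rho>' (d + 3)) ?t0 t1"
        "t1 (d + 3) = eval b (\<lambda>i. ?t0 (\<rho>' i))" "\<forall>r<d + 3. t1 r = ?t0 r"
      using Rec.IH(3) by blast
    have env: "(\<lambda>i. ?t0 (\<rho>' i)) = case_nat j (case_nat (rec_nat (eval a e) f j) e)"
    proof
      fix i
      have "\<rho> l \<noteq> d" "\<rho> l < d" for l
        using Rec.prems by (metis less_irrefl, simp)
      then show "?t0 (\<rho>' i) = case_nat j (case_nat (rec_nat (eval a e) f j) e) i"
        using Suc.prems(2-4) by (simp add: \<rho>'_def e_def split: nat.split)
    qed
    let ?t2 = "t1(d + 1 := 0)"
    let ?t3 = "?t2(d + 3 := 0, d + 1 := ?t2 (d + 1) + ?t2 (d + 3))"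
    let ?t4 = "?t3(d + 2 := Suc (?t3 (d + 2)))"
    have body: "big_step ?body ?t0 ?t4"
      by (rule Seq[OF t1(1) Seq[OF big_step_clear Seq[OF big_step_move Inc]]]) simp
    have "\<exists>s'. big_step (LOOP d ?body) ?t4 s' \<and> s' d = 0 \<and>
      s' (d + 1) = rec_nat (eval a e) f (Suc j + k) \<and> (\<forall>r<d. s' r = s r)"
    proof (rule Suc.IH)
      show "?t4 (d + 1) = rec_nat (eval a e) f (Suc j)"
        using t1(2) unfolding env by (simp add: f_def)
    qed (use t1(3) Suc.prems in auto)
    then show ?case using LoopS[OF Suc.prems(1) body] by auto
  qed
  have "\<exists>s'. big_step (LOOP d ?body) ?s3 s' \<and> s' d = 0 \<and>
      s' (d + 1) = rec_nat (eval a e) f (0 + eval n e) \<and> (\<forall>r<d. s' r = s r)"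
    by (rule loop) (use s1 s2 in auto)
  then obtain s4 where s4: "big_step (LOOP d ?body) ?s3 s4" "s4 d = 0"
      "s4 (d + 1) = rec_nat (eval a e) f (eval n e)" "\<forall>r<d. s4 r = s r"
    by auto
  let ?s5 = "s4(d + 1 := 0, d := s4 d + s4 (d + 1))"
  have "big_step (to_com (Rec n a b) \<rho> d) s ?s5"
    unfolding to_com.simps \<rho>'_def[symmetric]
    by (rule Seq[OF s1(1) Seq[OF s2(1) Seq[OF big_step_clear Seq[OF s4(1) big_step_move]]]]) simp
  moreover have "?s5 d = eval (Rec n a b) (\<lambda>i. s (\<rho> i))"
    using s4 by (simp add: f_def e_def)
  moreover have "\<forall>r<d. ?s5 r = s r"
    using s4(4) by simp
  ultimately show ?case by blast
qed

text \<open>Needed to find a register that the program never touches and that can serve as the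
  constant zero behind unconditional jumps.\<close>

lemma regs_to_com: "regs (to_com t \<rho> d) \<subseteq> range \<rho> \<union> {d..}"
proof (induction t arbitrary: \<rho> d)
  case (Rec n a b)
  let ?\<rho>' = "case_nat (d + 2) (case_nat (d + 1) \<rho>)"
  have "range ?\<rho>' \<union> {d + 3..} \<subseteq> range \<rho> \<union> {d..}"
    by (auto split: nat.split)
  then have "regs (to_com b ?\<rho>' (d + 3)) \<subseteq> range \<rho> \<union> {d..}"
    using Rec(3)[of ?\<rho>' "d + 3"] by (rule order_trans[rotated])
  moreover have "regs (to_com n \<rho> d) \<subseteq> range \<rho> \<union> {d..}"
    by (rule Rec(1))
  moreover have "regs (to_com a \<rho> (d + 1)) \<subseteq> range \<rho> \<union> {d..}"
    using Rec(2)[of \<rho> "d + 1"] by (rule order_trans) auto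
  ultimately show ?case
    by simp
qed auto

text \<open>Functions of a whole environment rather than of k arguments: arities disappear, and the
  closure properties below can be applied by unification under the binder.\<close>

definition PR :: "((nat \<Rightarrow> nat) \<Rightarrow> nat) \<Rightarrow> bool" where
  "PR F \<longleftrightarrow> (\<exists>t. eval t = F)"

lemma PR_rm_computes:
  assumes "PR (\<lambda>e. D (e 0) (e 1))"
  shows "\<exists>P. rm_computes P (\<lambda>a b. Some (D a b))"
proof -
  obtain t where t: "eval t = (\<lambda>e. D (e 0) (e 1))"
    using assms unfolding PR_def by blast
  \<comment> \<open>\<open>rm_init\<close> puts the inputs into registers 1 and 2; every other
    variable reads register 3, which is 0. Register 4 stays zero for the jumps, scratch space starts
    at 5, and the result is finally added to the empty register 0.\<close>
  define \<rho> :: "nat \<Rightarrow> nat" where "\<rho> = case_nat 1 (case_nat 2 (\<lambda>_. 3))"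
  define c where "c = SEQ (to_com t \<rho> 5) (LOOP 5 (INC 0))"
  have \<rho>: "\<rho> i < 5" "\<rho> i \<noteq> 0" "\<rho> i \<noteq> 4" for i
    by (auto simp: \<rho>_def split: nat.split)
  have "4 \<notin> regs c"
    using regs_to_com[of t \<rho> 5] \<rho>(3) by (fastforce simp: c_def)
  have "\<exists>t. length (compile 4 c 0) \<le> fst (rm_run (compile 4 c 0) t (rm_init a b)) \<and>
      snd (rm_run (compile 4 c 0) t (rm_init a b)) 0 = D a b" for a b
  proof -
    let ?s = "(\<lambda>_. 0)(1 := a, 2 := b) :: nat \<Rightarrow> nat"
    obtain s' where s': "big_step (to_com t \<rho> 5) ?s s'" "s' 5 = eval t (\<lambda>i. ?s (\<rho> i))"
        "\<forall>r<5. s' r = ?s r"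
      using to_com_correct[of \<rho> 5 t ?s] \<rho>(1) by blast
    let ?s'' = "s'(5 := 0, 0 := s' 0 + s' 5)"
    have "big_step c ?s ?s''"
      unfolding c_def by (rule Seq[OF s'(1) big_step_move]) simp
    then obtain k where "rm_run (compile 4 c 0) k (0, ?s) = (code_size c, ?s'')"
      using compile_correct[of c ?s ?s'' 4 "[]" "[]"] \<open>4 \<notin> regs c\<close> by auto
    moreover have "?s'' 0 = D a b"
      using s' by (simp add: t \<rho>_def)
    ultimately show ?thesis
      by (intro exI[of _ k]) (simp add: rm_init_def)
  qed
  then show ?thesis using rm_computes_total by blast
qed

section \<open>Closure of primitive recursive functions under substitution and arithmetic\<close>

primrec rename :: "tm \<Rightarrow> (nat \<Rightarrow> nat) \<Rightarrow> tm" where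
  "rename (Var i) r = Var (r i)"
| "rename Zero r = Zero"
| "rename (Succ t) r = Succ (rename t r)"
| "rename (Rec n a b) r =
     Rec (rename n r) (rename a r) (rename b (case_nat 0 (case_nat (Suc 0) (\<lambda>i. Suc (Suc (r i))))))"

lemma eval_rename: "eval (rename t r) e = eval t (\<lambda>i. e (r i))"
proof (induction t arbitrary: r e)
  case (Rec n a b)
  have "(\<lambda>k. case_nat i (case_nat x e) (case_nat 0 (case_nat (Suc 0) (\<lambda>i. Suc (Suc (r i)))) k)) =
      case_nat i (case_nat x (\<lambda>i. e (r i)))" for i x
    by (auto simp: fun_eq_iff split: nat.split)
  with Rec show ?case by simp
qed auto

lemma PR_var: "PR (\<lambda>e. e i)"
  unfolding PR_def by (rule exI[of _ "Var i"]) (simp add: fun_eq_iff)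

lemma PR_zero: "PR (\<lambda>e. 0)"
  unfolding PR_def by (rule exI[of _ Zero]) (simp add: fun_eq_iff)

lemma PR_Suc: "PR f \<Longrightarrow> PR (\<lambda>e. Suc (f e))"
  unfolding PR_def by (metis eval.simps(3))

lemma PR_const: "PR (\<lambda>e. k)"
  by (induction k) (auto intro: PR_zero PR_Suc)

lemma PR_rename: "PR f \<Longrightarrow> PR (\<lambda>e. f (\<lambda>i. e (r i)))"
  unfolding PR_def by (metis eval_rename)

text \<open>\<open>B\<close> depends on the outer environment, which inside the body sits two places
  higher, behind the index and the accumulator.\<close>

lemma PR_rec:
  assumes "PR A" "PR N" "PR (\<lambda>e. B (\<lambda>i. e (Suc (Suc i))) (e 0) (e 1))"
  shows "PR (\<lambda>e. rec_nat (A e) (B e) (N e))"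
proof -
  obtain a n b where t: "eval a = A" "eval n = N"
      "eval b = (\<lambda>e. B (\<lambda>i. e (Suc (Suc i))) (e 0) (e 1))"
    using assms unfolding PR_def by blast
  have "eval (Rec n a b) = (\<lambda>e. rec_nat (A e) (B e) (N e))"
    by (simp add: fun_eq_iff t)
  then show ?thesis unfolding PR_def by blast
qed

text \<open>The term language has no composition. A recursion of exactly one pass simulates it: the
  accumulator starts as \<open>g e\<close>, and the body \<open>H\<close> reads it as variable
  0.\<close>

lemma PR_subst:
  assumes "PR H" "PR g"
  shows "PR (\<lambda>e. H (case_nat (g e) (\<lambda>i. e (r i))))"
proof -
  have eq: "H (\<lambda>k. e (case_nat 1 (\<lambda>i. Suc (Suc (r i))) k)) =
      H (case_nat (e 1) (\<lambda>i. e (Suc (Suc (r i)))))" for e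
    by (rule arg_cong[of _ _ H]) (auto simp: fun_eq_iff split: nat.split)
  have "PR (\<lambda>e. H (case_nat (e 1) (\<lambda>i. e (Suc (Suc (r i))))))"
    using PR_rename[OF assms(1), of "case_nat 1 (\<lambda>i. Suc (Suc (r i)))"] unfolding eq .
  then have "PR (\<lambda>e. rec_nat (g e) (\<lambda>_ acc. H (case_nat acc (\<lambda>i. e (r i)))) 1)"
    by (intro PR_rec assms(2) PR_const)
  then show ?thesis by simp
qed

lemma PR_comp1: "PR (\<lambda>e. f (e 0)) \<Longrightarrow> PR g \<Longrightarrow> PR (\<lambda>e. f (g e))"
  using PR_subst[of "\<lambda>e. f (e 0)" g] by simp

lemma PR_comp2:
  assumes "PR (\<lambda>e. f (e 0) (e 1))" "PR g" "PR h"
  shows "PR (\<lambda>e. f (g e) (h e))"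
proof -
  have "PR (\<lambda>e. f (g (\<lambda>i. e (Suc i))) (e 0))"
    using PR_subst[OF assms(1) PR_rename[OF assms(2), of Suc], of "\<lambda>i. i"] by simp
  from PR_subst[OF this assms(3), of "\<lambda>i. i"] show ?thesis by simp
qed

lemma PR_comp3:
  assumes "PR (\<lambda>e. f (e 0) (e 1) (e 2))" "PR g" "PR h" "PR k"
  shows "PR (\<lambda>e. f (g e) (h e) (k e))"
proof -
  have "PR (\<lambda>e. f (g (\<lambda>i. e (Suc (Suc i)))) (e 0) (e 1))"
    using PR_subst[OF assms(1) PR_rename[OF assms(2), of "\<lambda>i. Suc (Suc i)"], of "\<lambda>i. i"]
    by (simp add: numeral_2_eq_2)
  from PR_subst[OF this PR_rename[OF assms(3), of Suc], of "\<lambda>i. i"]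
  have "PR (\<lambda>e. f (g (\<lambda>i. e (Suc i))) (h (\<lambda>i. e (Suc i))) (e 0))"
    by simp
  from PR_subst[OF this assms(4), of "\<lambda>i. i"] show ?thesis by simp
qed

lemma PR_add: "PR f \<Longrightarrow> PR g \<Longrightarrow> PR (\<lambda>e. f e + g e)"
proof (rule PR_comp2[of "(+)"])
  have "a + b = rec_nat a (\<lambda>_ x. Suc x) b" for a b
    by (induction b) auto
  then show "PR (\<lambda>e. e 0 + e 1)"
    by (simp only:) (intro PR_rec PR_Suc PR_var)
qed

lemma PR_mult: "PR f \<Longrightarrow> PR g \<Longrightarrow> PR (\<lambda>e. f e * g e)"
proof (rule PR_comp2[of "(*)"])
  have "a * b = rec_nat 0 (\<lambda>_ x. x + a) b" for a b :: nat
    by (induction b) auto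
  then show "PR (\<lambda>e. e 0 * e 1)"
    by (simp only:) (intro PR_rec PR_add PR_zero PR_var)
qed

lemma PR_power: "PR f \<Longrightarrow> PR g \<Longrightarrow> PR (\<lambda>e. f e ^ g e)"
proof (rule PR_comp2[of "(^)"])
  have "a ^ b = rec_nat 1 (\<lambda>_ x. x * a) b" for a b :: nat
    by (induction b) auto
  then show "PR (\<lambda>e. e 0 ^ e 1)"
    by (simp only:) (intro PR_rec PR_mult PR_const PR_var)
qed

lemma PR_diff: "PR f \<Longrightarrow> PR g \<Longrightarrow> PR (\<lambda>e. f e - g e)"
proof (rule PR_comp2[of "(-)"])
  \<comment> \<open>The recursor also hands over the index, and its last value is the
    predecessor.\<close>
  have pred: "x - 1 = rec_nat 0 (\<lambda>i _. i) x" for x :: nat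
    by (cases x) auto
  have "PR (\<lambda>e. e 0 - 1)"
    unfolding pred by (intro PR_rec PR_zero PR_var)
  then have pred: "PR h \<Longrightarrow> PR (\<lambda>e. h e - 1)" for h
    by (rule PR_comp1)
  have "a - b = rec_nat a (\<lambda>_ x. x - 1) b" for a b :: nat
    by (induction b) auto
  then have "(\<lambda>e. rec_nat (e 0) (\<lambda>_ x. x - 1) (e 1 :: nat)) = (\<lambda>e. e 0 - e 1)"
    by metis
  moreover have "PR (\<lambda>e. rec_nat (e 0) (\<lambda>_ x. x - 1) (e 1))"
    by (intro PR_rec pred PR_var)
  ultimately show "PR (\<lambda>e. e 0 - e 1)"
    by (rule subst[of _ _ PR])
qed

text \<open>Sums over initial segments are the only search device: bounded quantifiers,
  cardinalities and the selection of a unique solution are all reduced to them.\<close>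

lemma PR_sum:
  assumes "PR N" "PR (\<lambda>e. F (\<lambda>i. e (Suc i)) (e 0))"
  shows "PR (\<lambda>e. \<Sum>i<N e. F e i)"
proof -
  have "(\<Sum>i<k. F e i) = rec_nat 0 (\<lambda>i x. x + F e i) k" for k e
    by (induction k) auto
  moreover have "PR (\<lambda>e. F (\<lambda>i. e (Suc (Suc i))) (e 0))"
    using PR_rename[OF assms(2), of "case_nat 0 (\<lambda>i. Suc (Suc i))"] by simp
  then have "PR (\<lambda>e. rec_nat 0 (\<lambda>i x. x + F e i) (N e))"
    by (intro PR_rec PR_add assms(1) PR_zero PR_var)
  ultimately show ?thesis by simp
qed

section \<open>Decidable predicates, bounded quantifiers and counting\<close>

definition PRP :: "((nat \<Rightarrow> nat) \<Rightarrow> bool) \<Rightarrow> bool" where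
  "PRP P \<longleftrightarrow> PR (\<lambda>e. if P e then 1 else 0)"

lemma PRP_zero: "PR f \<Longrightarrow> PRP (\<lambda>e. f e = 0)"
proof -
  assume "PR f"
  then have "PR (\<lambda>e. 1 - f e)"
    by (intro PR_diff PR_const)
  moreover have "(\<lambda>e. 1 - f e) = (\<lambda>e. if f e = 0 then 1 else 0)"
    by auto
  ultimately show ?thesis by (simp add: PRP_def)
qed

lemma PRP_not: "PRP P \<Longrightarrow> PRP (\<lambda>e. \<not> P e)"
proof -
  assume "PRP P"
  then have "PRP (\<lambda>e. (if P e then 1 else (0::nat)) = 0)"
    by (intro PRP_zero) (simp add: PRP_def)
  moreover have "(\<lambda>e. (if P e then 1 else (0::nat)) = 0) = (\<lambda>e. \<not> P e)"
    by auto
  ultimately show ?thesis by simp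
qed

lemma PR_if:
  assumes "PRP P" "PR f" "PR g"
  shows "PR (\<lambda>e. if P e then f e else g e)"
proof -
  have "PR (\<lambda>e. (if P e then 1 else 0) * f e + (1 - (if P e then 1 else 0)) * g e)"
    using assms by (intro PR_add PR_mult PR_diff PR_const) (auto simp: PRP_def)
  moreover have "(\<lambda>e. (if P e then 1 else 0) * f e + (1 - (if P e then 1 else 0)) * g e) =
      (\<lambda>e. if P e then f e else g e)"
    by auto
  ultimately show ?thesis by metis
qed

lemma PRP_conj:
  assumes "PRP P" "PRP Q"
  shows "PRP (\<lambda>e. P e \<and> Q e)"
proof -
  have "PR (\<lambda>e. if P e then (if Q e then 1 else 0) else 0)"
    using assms PR_if[OF assms(1) _ PR_zero] by (simp add: PRP_def)
  moreover have "(\<lambda>e. if P e then (if Q e then 1 else 0) else 0) =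
      (\<lambda>e. if P e \<and> Q e then 1 else (0::nat))"
    by auto
  ultimately show ?thesis by (simp only: PRP_def)
qed

lemma PRP_le: "PR f \<Longrightarrow> PR g \<Longrightarrow> PRP (\<lambda>e. f e \<le> g e)"
  using PRP_zero[OF PR_diff[of f g]] by simp

lemma PRP_less: "PR f \<Longrightarrow> PR g \<Longrightarrow> PRP (\<lambda>e. f e < g e)"
  using PRP_le[of "\<lambda>e. Suc (f e)" g] PR_Suc by (simp add: Suc_le_eq)

lemma PRP_eq: "PR f \<Longrightarrow> PR g \<Longrightarrow> PRP (\<lambda>e. f e = g e)"
  using PRP_conj[OF PRP_le[of f g] PRP_le[of g f]] by (simp add: eq_iff)

lemma PRP_ex:
  assumes "PR N" "PRP (\<lambda>e. P (\<lambda>i. e (Suc i)) (e 0))"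
  shows "PRP (\<lambda>e. \<exists>i<N e. P e i)"
proof -
  have "PRP (\<lambda>e. \<not> (\<Sum>i<N e. if P e i then 1 else 0) = (0::nat))"
    using assms by (intro PRP_not PRP_zero PR_sum) (auto simp: PRP_def)
  moreover have "(\<not> (\<Sum>i<N e. if P e i then 1 else 0) = (0::nat)) \<longleftrightarrow> (\<exists>i<N e. P e i)" for e
    by auto
  ultimately show ?thesis by simp
qed

lemma PRP_all:
  assumes "PR N" "PRP (\<lambda>e. P (\<lambda>i. e (Suc i)) (e 0))"
  shows "PRP (\<lambda>e. \<forall>i<N e. P e i)"
  using PRP_not[OF PRP_ex[OF assms(1), of "\<lambda>e i. \<not> P e i"]] PRP_not[OF assms(2)] by simp

lemma PR_card:
  assumes "PR N" "PRP (\<lambda>e. P (\<lambda>i. e (Suc i)) (e 0))"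
  shows "PR (\<lambda>e. card {i. i < N e \<and> P e i})"
proof -
  have "card {i. i < N e \<and> P e i} = (\<Sum>i<N e. if P e i then 1 else 0)" for e
    by (simp add: sum.If_cases Int_def)
  moreover have "PR (\<lambda>e. \<Sum>i<N e. if P e i then 1 else 0)"
    using assms by (intro PR_sum) (auto simp: PRP_def)
  ultimately show ?thesis by simp
qed

lemma PR_div: "PR f \<Longrightarrow> PR g \<Longrightarrow> PR (\<lambda>e. f e div g e)"
proof (rule PR_comp2[of "(div)"])
  \<comment> \<open>The quotient counts the positive multiples of \<open>b\<close> up to
    \<open>a\<close>. The case \<open>b = 0\<close> is separate because there every
    \<open>i < a\<close> would be counted, while HOL sets the quotient to 0.\<close>
  have "a div b = (if b = 0 then 0 else card {i. i < a \<and> Suc i * b \<le> a})" for a b :: nat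
  proof (cases "b = 0")
    case False
    have "Suc i * b \<le> a \<longleftrightarrow> i < a div b" for i
      using False by (metis Suc_le_eq less_eq_div_iff_mult_less_eq neq0_conv)
    moreover have "i < a div b \<Longrightarrow> i < a" for i
      by (rule less_le_trans[OF _ div_le_dividend])
    ultimately have "{i. i < a \<and> Suc i * b \<le> a} = {..<a div b}"
      by auto
    with False show ?thesis by simp
  qed simp
  then show "PR (\<lambda>e. e 0 div e 1)"
    by (simp only:) (intro PR_if PRP_zero PR_card PRP_le PR_mult PR_Suc PR_zero PR_var)
qed

lemma PR_mod: "PR f \<Longrightarrow> PR g \<Longrightarrow> PR (\<lambda>e. f e mod g e)"
  unfolding modulo_nat_def by (intro PR_diff PR_mult PR_div)

lemma PRP_odd: "PR f \<Longrightarrow> PRP (\<lambda>e. odd (f e))"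
  unfolding odd_iff_mod_2_eq_one by (intro PRP_eq PR_mod PR_const)

section \<open>Codes of pairs and lists\<close>

lemma PR_prod_encode: "PR f \<Longrightarrow> PR g \<Longrightarrow> PR (\<lambda>e. prod_encode (f e, g e))"
  unfolding prod_encode_def triangle_def prod.case
  by (intro PR_add PR_div PR_mult PR_Suc PR_const)

text \<open>Inverting the pairing by bounded search: both components are at most the code and the
  pair is unique, so only the true first component can contribute.\<close>

lemma fst_prod_decode_eq_sum:
  "fst (prod_decode y) = (\<Sum>a<Suc y. if \<exists>b<Suc y. prod_encode (a, b) = y then a else 0)"
proof -
  obtain a b where ab: "prod_decode y = (a, b)"
    by (cases "prod_decode y")
  then have y: "prod_encode (a, b) = y"
    by (metis prod_decode_inverse)
  then have "a \<le> y" "b \<le> y"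
    using le_prod_encode_1[of a b] le_prod_encode_2[of b a] by simp_all
  have unique: "a' = a" if "prod_encode (a', b') = y" for a' b'
    using that ab prod_encode_inverse[of "(a', b')"] by simp
  have ex: "(\<exists>b<Suc y. prod_encode (a', b) = y) \<longleftrightarrow> a' = a" for a'
    using y \<open>b \<le> y\<close> unique less_Suc_eq_le by blast
  have "(\<Sum>a'<Suc y. if a' = a then a' else 0) = a"
    using \<open>a \<le> y\<close> by (subst sum.delta) (simp_all del: sum.lessThan_Suc)
  then show ?thesis
    unfolding ex ab by (simp only: fst_conv)
qed

lemma PR_fst_prod_decode: "PR f \<Longrightarrow> PR (\<lambda>e. fst (prod_decode (f e)))"
proof (rule PR_comp1[of "\<lambda>y. fst (prod_decode y)" f])
  show "PR (\<lambda>e. fst (prod_decode (e 0)))"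
    unfolding fst_prod_decode_eq_sum
    by (intro PR_sum PR_if PRP_ex PRP_eq PR_prod_encode PR_Suc PR_zero PR_var)
qed

text \<open>A list code is built from the tail, so the recursion runs from the last entry to the
  first and reads entry \<open>k - Suc i\<close> in pass \<open>i\<close>.\<close>

lemma PR_list_encode:
  assumes "PR N" "PR (\<lambda>e. F (\<lambda>i. e (Suc i)) (e 0))"
  shows "PR (\<lambda>e. list_encode (map (F e) [0..<N e]))"
proof -
  have "j \<le> k \<Longrightarrow> list_encode (map (F e) [k - j..<k]) =
      rec_nat 0 (\<lambda>i x. Suc (prod_encode (F e (k - Suc i), x))) j" for j k e
  proof (induction j)
    case (Suc j)
    then have "[k - Suc j..<k] = (k - Suc j) # [k - j..<k]"
      by (simp add: upt_conv_Cons Suc_diff_Suc)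
    with Suc show ?case by simp
  qed simp
  from this[OF order_refl] have eq: "list_encode (map (F e) [0..<k]) =
      rec_nat 0 (\<lambda>i x. Suc (prod_encode (F e (k - Suc i), x))) k" for k e
    by simp
  have "PR (\<lambda>e. N (\<lambda>i. e (Suc (Suc i))) - Suc (e 0))"
    by (intro PR_diff PR_rename[OF assms(1)] PR_Suc PR_var)
  from PR_subst[OF assms(2) this, of "\<lambda>i. Suc (Suc i)"]
  have "PR (\<lambda>e. F (\<lambda>i. e (Suc (Suc i))) (N (\<lambda>i. e (Suc (Suc i))) - Suc (e 0)))"
    by simp
  then have "PR (\<lambda>e. rec_nat 0 (\<lambda>i x. Suc (prod_encode (F e (N e - Suc i), x))) (N e))"
    by (intro PR_rec PR_Suc PR_prod_encode PR_var PR_zero assms(1))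
  then show ?thesis by (simp only: eq)
qed

lemmas PR_intros = PR_add PR_mult PR_power PR_diff PR_Suc PR_sum PR_if PR_card PR_div PR_mod
  PR_var PR_const PRP_not PRP_conj PRP_le PRP_less PRP_eq PRP_ex PRP_all PRP_odd

subsection \<open>Upper bounds on Kolmogorov complexity\<close>

lemma nat_of_bits_of_nat [simp]: "nat_of_bits (bits_of_nat n) = n"
  by (induction n rule: bits_of_nat.induct) auto

lemma bits_of_nat_of_bits [simp]: "bits_of_nat (nat_of_bits bs) = bs"
  by (induction bs) auto

lemma length_bits_of_nat:
  "2 ^ length (bits_of_nat n) \<le> Suc n \<and> Suc n < 2 * 2 ^ length (bits_of_nat n)"
proof (induction n rule: bits_of_nat.induct)
  case (2 n)
  have "2 * p \<le> Suc (Suc n) \<and> Suc (Suc n) < 2 * (2 * p)"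
    if "p \<le> Suc (n div 2) \<and> Suc (n div 2) < 2 * p" for p
    using that by presburger
  from this[OF 2] show ?case by simp
qed simp

text \<open>Turns the length of a string into an arithmetic condition on its code, which primitive
  recursive terms can test.\<close>

lemma length_bits_of_nat_eq_iff:
  "length (bits_of_nat n) = k \<longleftrightarrow> 2 ^ k \<le> Suc n \<and> Suc n < 2 * 2 ^ k"
proof -
  have less: "k < Suc l" if "2 ^ k \<le> m" "m < 2 * 2 ^ l" for k l m :: nat
  proof -
    have "(2::nat) ^ k < 2 ^ Suc l"
      using le_less_trans[OF that] by simp
    then show ?thesis
      using power_less_imp_less_exp[of "2::nat" k "Suc l"] by simp
  qed
  show ?thesis
  proof
    assume "2 ^ k \<le> Suc n \<and> Suc n < 2 * 2 ^ k"
    then have "k < Suc (length (bits_of_nat n))" "length (bits_of_nat n) < Suc k"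
      using less[of k "Suc n"] less[of _ "Suc n" k] length_bits_of_nat[of n] by blast+
    then show "length (bits_of_nat n) = k"
      by linarith
  qed (use length_bits_of_nat[of n] in blast)
qed

lemma nth_bits_of_nat:
  "i < length (bits_of_nat n) \<Longrightarrow> bits_of_nat n ! i \<longleftrightarrow> odd (Suc n div 2 ^ i)"
proof (induction n arbitrary: i rule: bits_of_nat.induct)
  case (2 n)
  show ?case
  proof (cases i)
    case (Suc j)
    have "Suc (Suc n) div 2 ^ i = Suc (n div 2) div 2 ^ j"
      using Suc by (simp add: div_mult2_eq)
    with 2 Suc show ?thesis by simp
  qed simp
qed simp

text \<open>The decoder's program is the number \<open>m\<close> itself, a string of at most log(m +
  1) bits. As \<open>y\<close> is supplied separately, nothing has to be delimited, and the constant
  depends on \<open>D\<close> only.\<close>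

lemma KC_le_log:
  assumes "universal U" "PR (\<lambda>e. D (e 0) (e 1))"
  shows "\<exists>c. \<forall>m y. real (KC U (bits_of_nat (D m y)) (bits_of_nat y)) \<le> log 2 (real (Suc m)) + real c"
proof -
  define \<psi> where "\<psi> p y = Some (bits_of_nat (D (nat_of_bits p) (nat_of_bits y)))" for p y
  have "computable \<psi>"
    using PR_rm_computes[OF assms(2)] by (simp add: computable_def \<psi>_def)
  then obtain c where c: "\<And>x y p. \<psi> p y = Some x \<Longrightarrow> KC U x y \<le> length p + c"
    using assms(1) unfolding universal_def by blast
  have "real (KC U (bits_of_nat (D m y)) (bits_of_nat y)) \<le> log 2 (real (Suc m)) + real c" for m y
  proof -
    have "2 ^ length (bits_of_nat m) \<le> real (Suc m)"
      using length_bits_of_nat[of m] by (metis of_nat_le_iff of_nat_numeral of_nat_power)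
    then have "real (length (bits_of_nat m)) \<le> log 2 (real (Suc m))"
      by (subst le_log_iff) (auto simp: powr_realpow)
    moreover have "KC U (bits_of_nat (D m y)) (bits_of_nat y) \<le> length (bits_of_nat m) + c"
      by (rule c) (simp add: \<psi>_def)
    ultimately show ?thesis by linarith
  qed
  then show ?thesis by blast
qed

text \<open>\<open>x\<close> is described by the number of smaller solutions of \<open>Q\<close>.
  The computable bound \<open>B\<close> makes the search for \<open>x\<close> bounded, hence
  primitive recursive.\<close>

lemma KC_le_log_card:
  assumes "universal U" "PRP (\<lambda>e. Q (e 0) (e 1))" "PR (\<lambda>e. B (e 0))"
  shows "\<exists>c. \<forall>x y. x < B y \<and> Q x y \<longrightarrow>
    real (KC U (bits_of_nat x) (bits_of_nat y)) \<le> log 2 (real (card {x. x < B y \<and> Q x y})) + real c"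
proof -
  define D where
    "D m y = (\<Sum>x<B y. if Q x y \<and> card {x'. x' < x \<and> Q x' y} = m then x else 0)" for m y
  have Q: "PR f \<Longrightarrow> PR g \<Longrightarrow> PRP (\<lambda>e. Q (f e) (g e))" for f g
    using PR_comp2[of "\<lambda>x y. if Q x y then 1 else 0" f g] assms(2) by (simp add: PRP_def)
  have "PR (\<lambda>e. D (e 0) (e 1))"
    unfolding D_def by (intro PR_intros Q PR_comp1[OF assms(3)])
  from KC_le_log[OF assms(1) this] obtain c where
    c: "real (KC U (bits_of_nat (D m y)) (bits_of_nat y)) \<le> log 2 (real (Suc m)) + real c" for m y
    by blast
  have "real (KC U (bits_of_nat x) (bits_of_nat y)) \<le>
      log 2 (real (card {x. x < B y \<and> Q x y})) + real c" if "x < B y" "Q x y" for x y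
  proof -
    define m where "m = card {x'. x' < x \<and> Q x' y}"
    have less: "card {x'. x' < a \<and> Q x' y} < card {x'. x' < b \<and> Q x' y}"
      if "a < b" "Q a y" for a b
    proof (rule psubset_card_mono)
      show "{x'. x' < a \<and> Q x' y} \<subset> {x'. x' < b \<and> Q x' y}"
        using that by auto
    qed simp
    \<comment> \<open>Ranks strictly increase along the solutions of \<open>Q\<close>, so the sum in
      \<open>D\<close> keeps only the term \<open>x\<close>.\<close>
    have "Q z y \<and> card {x'. x' < z \<and> Q x' y} = m \<longleftrightarrow> z = x" for z
      using less[of x z] less[of z x] that unfolding m_def by (cases x z rule: linorder_cases) auto
    then have D: "D m y = x"
      using that(1) by (simp add: D_def)
    have "Suc m \<le> card {x. x < B y \<and> Q x y}"
      using less[OF that] unfolding m_def by simp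
    then have "log 2 (real (Suc m)) \<le> log 2 (real (card {x. x < B y \<and> Q x y}))"
      by simp
    with c[of m y] show ?thesis unfolding D by linarith
  qed
  then show ?thesis by blast
qed

subsection \<open>Graph codes\<close>

text \<open>Start of row \<open>i\<close> in the lexicographic order of edges: node a + 1 has n - (a
  + 1) larger partners.\<close>

definition edge_offset :: "nat \<Rightarrow> nat \<Rightarrow> nat" where
  "edge_offset n i = (\<Sum>a<i - 1. n - Suc a)"

definition edge_index :: "nat \<Rightarrow> nat \<Rightarrow> nat \<Rightarrow> nat" where
  "edge_index n u v =
     (if u < v then edge_offset n u + (v - Suc u) else edge_offset n v + (u - Suc v))"

lemma edge_index_commute: "edge_index n u v = edge_index n v u"
  by (cases u v rule: linorder_cases) (auto simp: edge_index_def)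

lemma length_edge_rows:
  "length (concat (map (\<lambda>i. map (adj i) [Suc i..<Suc n]) [1..<Suc k])) = edge_offset n (Suc k)"
  by (induction k) (auto simp: edge_offset_def simp del: upt_Suc simp add: upt_Suc_append)

lemma edge_offset_Suc: "i \<ge> 1 \<Longrightarrow> edge_offset n (Suc i) = edge_offset n i + (n - i)"
  by (cases i) (auto simp: edge_offset_def)

lemma edge_offset_mono: "i \<le> j \<Longrightarrow> edge_offset n i \<le> edge_offset n j"
  unfolding edge_offset_def by (rule sum_mono2) auto

lemma edge_offset_top: "edge_offset n (Suc n) = n * (n - 1) div 2"
proof -
  have "(\<Sum>a<n. n - Suc a) = (\<Sum>a<n. a)"
    by (rule sum.nat_diff_reindex)
  also have "\<dots> = n * (n - 1) div 2"
    using Sum_Ico_nat[of 0 n] by (simp add: atLeast0LessThan)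
  finally show ?thesis by (simp add: edge_offset_def)
qed

lemma length_edge_code: "length (edge_code n adj) = n * (n - 1) div 2"
  unfolding edge_code_def length_edge_rows edge_offset_top ..

lemma edge_index_bounds:
  assumes "i < j" "j \<le> n" "1 \<le> i"
  shows "edge_offset n i \<le> edge_index n i j" "edge_index n i j < edge_offset n (Suc i)"
  using assms by (simp_all add: edge_index_def edge_offset_Suc)

lemma edge_index_less:
  assumes "u \<in> {1..n}" "v \<in> {1..n}" "u \<noteq> v"
  shows "edge_index n u v < n * (n - 1) div 2"
proof -
  have *: "edge_index n i j < n * (n - 1) div 2" if "i < j" "j \<le> n" "1 \<le> i" for i j
    using edge_index_bounds(2)[OF that] edge_offset_mono[of "Suc i" "Suc n" n] that
    by (simp add: edge_offset_top)
  show ?thesis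
    using assms *[of u v] *[of v u] edge_index_commute[of n u v]
    by (cases u v rule: linorder_cases) auto
qed

text \<open>Rows belonging to different smaller endpoints occupy disjoint intervals of positions;
  within a row the position fixes the larger endpoint.\<close>

lemma edge_index_inject:
  assumes "u \<in> {1..n}" "v \<in> {1..n}" "u \<noteq> v" "u' \<in> {1..n}" "v' \<in> {1..n}" "u' \<noteq> v'"
    and eq: "edge_index n u v = edge_index n u' v'"
  shows "u = u' \<and> v = v' \<or> u = v' \<and> v = u'"
proof -
  have le: "i' \<le> i" if "i < j" "j \<le> n" "1 \<le> i" "i' < j'" "j' \<le> n" "1 \<le> i'"
      "edge_index n i j = edge_index n i' j'" for i j i' j'
  proof (rule ccontr)
    assume "\<not> i' \<le> i"
    then have "edge_offset n (Suc i) \<le> edge_offset n i'"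
      by (intro edge_offset_mono) simp
    with edge_index_bounds[OF that(1-3)] edge_index_bounds[OF that(4-6)] that(7)
    show False by simp
  qed
  have ordered: "i = i' \<and> j = j'" if "i < j" "j \<le> n" "1 \<le> i" "i' < j'" "j' \<le> n" "1 \<le> i'"
      "edge_index n i j = edge_index n i' j'" for i j i' j'
  proof -
    have "i = i'"
      using le[OF that] le[OF that(4-6,1-3) that(7)[symmetric]] by simp
    with that show ?thesis by (simp add: edge_index_def)
  qed
  have minmax: "edge_index n (min x y) (max x y) = edge_index n x y" for x y
    using edge_index_commute[of n x y] by (simp add: min_def max_def)
  have "min u v = min u' v' \<and> max u v = max u' v'"
  proof (rule ordered)
    show "edge_index n (min u v) (max u v) = edge_index n (min u' v') (max u' v')"
      unfolding minmax by (rule eq)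
  qed (use assms in auto)
  then show ?thesis
    by (simp add: min_def max_def split: if_splits)
qed

lemma nth_edge_code:
  assumes "graph_on n adj" "u \<in> {1..n}" "v \<in> {1..n}" "u \<noteq> v"
  shows "edge_code n adj ! edge_index n u v \<longleftrightarrow> adj u v"
proof -
  have *: "edge_code n adj ! edge_index n i j \<longleftrightarrow> adj i j" if ij: "i < j" "j \<le> n" "1 \<le> i" for i j
  proof -
    obtain k where k: "i = Suc k"
      using ij by (cases i) auto
    let ?row = "\<lambda>i. map (adj i) [Suc i..<Suc n]"
    have "[1..<Suc n] = [1..<Suc k] @ i # [Suc i..<Suc n]"
      using ij k upt_add_eq_append[of 1 "Suc k" "n - k"] by (simp add: upt_conv_Cons del: upt_Suc)
    then have "edge_code n adj =
        concat (map ?row [1..<Suc k]) @ ?row i @ concat (map ?row [Suc i..<Suc n])"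
      unfolding edge_code_def by (simp del: upt_Suc)
    moreover have "edge_index n i j = length (concat (map ?row [1..<Suc k])) + (j - Suc i)"
      unfolding length_edge_rows using ij k by (simp add: edge_index_def)
    ultimately have "edge_code n adj ! edge_index n i j =
        (?row i @ concat (map ?row [Suc i..<Suc n])) ! (j - Suc i)"
      by (simp only: nth_append_length_plus)
    also have "\<dots> = adj i j"
      using ij less_imp_diff_less[of j "Suc n" "Suc i"] diff_less_mono[of j "Suc n" "Suc i"]
      by (simp add: nth_append del: upt_Suc)
    finally show ?thesis .
  qed
  have "adj u v = adj v u"
    using assms(1) unfolding graph_on_def by blast
  with assms *[of u v] *[of v u] edge_index_commute[of n u v] show ?thesis
    by (cases u v rule: linorder_cases) auto
qed

text \<open>The bits of \<open>x\<close> are the binary digits of \<open>Suc x\<close> without the leading 1 (see \<open>nth_bits_of_nat\<close>).\<close>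
definition edges_of :: "nat \<Rightarrow> nat \<Rightarrow> nat set" where
  "edges_of n x = {i. i < n * (n - 1) div 2 \<and> odd (Suc x div 2 ^ i)}"

lemma edges_of_edge_code:
  assumes "graph_on n adj" "u \<in> {1..n}" "v \<in> {1..n}" "u \<noteq> v"
  shows "edge_index n u v \<in> edges_of n (nat_of_bits (edge_code n adj)) \<longleftrightarrow> adj u v"
  using edge_index_less[OF assms(2-4)] nth_edge_code[OF assms]
    nth_bits_of_nat[of "edge_index n u v" "nat_of_bits (edge_code n adj)"]
  by (simp add: edges_of_def length_edge_code)

text \<open>Codes of full length are determined by their edge sets. Counting bad codes thus becomes
  counting bad subsets of the positions, where the membership of different positions can be chosen
  independently.\<close>

lemma card_codes_le:
  "card {x. length (bits_of_nat x) = n * (n - 1) div 2 \<and> P (edges_of n x)} \<le>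
    card {F. F \<subseteq> {..<n * (n - 1) div 2} \<and> P F}"
proof (rule card_inj_on_le[where f = "edges_of n"])
  let ?N = "n * (n - 1) div 2"
  show "inj_on (edges_of n) {x. length (bits_of_nat x) = ?N \<and> P (edges_of n x)}"
  proof (rule inj_onI)
    fix x y assume xy: "x \<in> {x. length (bits_of_nat x) = ?N \<and> P (edges_of n x)}"
      "y \<in> {x. length (bits_of_nat x) = ?N \<and> P (edges_of n x)}" "edges_of n x = edges_of n y"
    have "bits_of_nat x ! i = bits_of_nat y ! i" if "i < ?N" for i
      using xy that nth_bits_of_nat[of i x] nth_bits_of_nat[of i y] by (auto simp: edges_of_def)
    then have "bits_of_nat x = bits_of_nat y"
      using xy by (intro nth_equalityI) auto
    then show "x = y" by (metis nat_of_bits_of_nat)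
  qed
  show "edges_of n ` {x. length (bits_of_nat x) = ?N \<and> P (edges_of n x)} \<subseteq> {F. F \<subseteq> {..<?N} \<and> P F}"
    by (auto simp: edges_of_def)
  show "finite {F. F \<subseteq> {..<?N} \<and> P F}"
    by (rule finite_subset[of _ "Pow {..<?N}"]) auto
qed

text \<open>Incompressibility in the form used below: a decidable property of a random graph cannot
  be too rare. \<open>P\<close> may depend on n because n is the conditional information; \<delta>
  does not enter the decoder, so \<open>c\<close> is uniform in it. Positivity of the count is
  recorded because monotonicity of the logarithm needs it.\<close>

lemma card_random_graph_code:
  assumes "universal U" "PRP (\<lambda>e. P (e 1) (edges_of (e 1) (e 0)))"
  shows "\<exists>c. \<forall>n adj \<delta>. random_graph U n \<delta> adj \<and> P n (edges_of n (nat_of_bits (edge_code n adj))) \<longrightarrow>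
    0 < card {F. F \<subseteq> {..<n * (n - 1) div 2} \<and> P n F} \<and>
    real (n * (n - 1) div 2) - \<delta> \<le>
      log 2 (real (card {F. F \<subseteq> {..<n * (n - 1) div 2} \<and> P n F})) + real c"
proof -
  define B :: "nat \<Rightarrow> nat" where "B n = 2 * 2 ^ (n * (n - 1) div 2)" for n
  define Q :: "nat \<Rightarrow> nat \<Rightarrow> bool" where "Q x n \<longleftrightarrow> 2 ^ (n * (n - 1) div 2) \<le> Suc x \<and> Suc x < B n \<and> P n (edges_of n x)" for x n
  have "PR (\<lambda>e. B (e 0))"
    unfolding B_def by (intro PR_intros)
  moreover have "PRP (\<lambda>e. Q (e 0) (e 1))"
    unfolding Q_def B_def by (intro PR_intros assms(2))
  ultimately obtain c where c: "\<And>x n. x < B n \<and> Q x n \<Longrightarrow>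
      real (KC U (bits_of_nat x) (bits_of_nat n)) \<le> log 2 (real (card {x. x < B n \<and> Q x n})) + real c"
    using KC_le_log_card[OF assms(1), of Q B] by blast
  have Q_iff: "x < B n \<and> Q x n \<longleftrightarrow>
      length (bits_of_nat x) = n * (n - 1) div 2 \<and> P n (edges_of n x)" for x n
    unfolding length_bits_of_nat_eq_iff Q_def B_def using Suc_lessD by blast
  show ?thesis
  proof (intro exI[of _ c] allI impI)
    fix n adj \<delta>
    define x where "x = nat_of_bits (edge_code n adj)"
    let ?S = "{x. x < B n \<and> Q x n}" and ?T = "{F. F \<subseteq> {..<n * (n - 1) div 2} \<and> P n F}"
    assume "random_graph U n \<delta> adj \<and> P n (edges_of n (nat_of_bits (edge_code n adj)))"
    then have G: "real (KC U (bits_of_nat x) (bits_of_nat n)) \<ge> real (n * (n - 1) div 2) - \<delta>"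
        "P n (edges_of n x)"
      by (simp_all add: random_graph_def x_def)
    have "length (bits_of_nat x) = n * (n - 1) div 2"
      by (simp add: x_def length_edge_code)
    with G have x: "x < B n \<and> Q x n"
      unfolding Q_iff by blast
    have "finite ?S"
      by (rule finite_subset[of _ "{..<B n}"]) auto
    with x have "0 < card ?S"
      unfolding card_gt_0_iff by blast
    moreover have "card ?S \<le> card ?T"
      unfolding Q_iff by (rule card_codes_le)
    ultimately have "0 < card ?T" "log 2 (real (card ?S)) \<le> log 2 (real (card ?T))"
      by (linarith, subst log_le_cancel_iff) linarith+
    then show "0 < card ?T \<and>
        real (n * (n - 1) div 2) - \<delta> \<le> log 2 (real (card ?T)) + real c"
      using c[OF x] G(1) by linarith
  qed
qed

subsection \<open>Counting graphs\<close>

text \<open>Markov's inequality for the exponential moment. The sum of exp(t |F \<inter> A|) over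
  all \<open>F\<close> factorises into 1 + exp t for each element of \<open>A\<close> and 2 for
  every other one.\<close>

lemma card_subsets_exp_le:
  fixes t a :: real
  assumes "finite E" "A \<subseteq> E"
  shows "real (card {F. F \<subseteq> E \<and> a \<le> t * real (card (F \<inter> A))}) * exp a \<le>
    (1 + exp t) ^ card A * 2 ^ (card E - card A)"
proof -
  let ?S = "{F. F \<subseteq> E \<and> a \<le> t * real (card (F \<inter> A))}"
  let ?w = "\<lambda>e. if e \<in> A then exp t else 1"
  have w: "(\<Prod>e\<in>F. ?w e) = exp (t * real (card (F \<inter> A)))" if "F \<subseteq> E" for F
  proof -
    have "finite F"
      using that assms(1) finite_subset by blast
    then have "(\<Prod>e\<in>F. ?w e) = exp t ^ card (F \<inter> A)"
      by (simp add: prod.If_cases Int_def)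
    then show ?thesis
      by (simp add: exp_of_nat_mult[symmetric] mult.commute)
  qed
  have "real (card ?S) * exp a = (\<Sum>F\<in>?S. exp a)"
    by simp
  also have "\<dots> \<le> (\<Sum>F\<in>?S. exp (t * real (card (F \<inter> A))))"
    by (rule sum_mono) simp
  also have "\<dots> \<le> (\<Sum>F\<in>Pow E. exp (t * real (card (F \<inter> A))))"
    by (rule sum_mono2) (use assms(1) in auto)
  also have "\<dots> = (\<Sum>F\<in>Pow E. (\<Prod>e\<in>F. ?w e) * (\<Prod>e\<in>E - F. 1))"
    by (rule sum.cong) (use w in auto)
  also have "\<dots> = (\<Prod>e\<in>E. ?w e + 1)"
    by (rule prod_add[symmetric]) (rule assms(1))
  also have "\<dots> = (\<Prod>e\<in>A. exp t + 1) * (\<Prod>e\<in>E - A. 2)"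
    using assms by (subst prod.subset_diff[OF assms(2,1)]) (auto simp: mult.commute intro!: arg_cong2[where f = "(*)"] prod.cong)
  also have "\<dots> = (1 + exp t) ^ card A * 2 ^ (card E - card A)"
    using card_Diff_subset[OF finite_subset[OF assms(2,1)] assms(2)] by (simp add: add.commute)
  finally show ?thesis .
qed

text \<open>The pairs {p w, q w} are disjoint, and on each of them three of the four patterns are
  allowed. The induction removes one pair; multiplying out keeps the statement in the natural
  numbers.\<close>

lemma card_avoiding_pairs_le:
  assumes "finite W" "finite E" "inj_on p W" "inj_on q W" "p ` W \<inter> q ` W = {}" "p ` W \<union> q ` W \<subseteq> E"
  shows "card {F. F \<subseteq> E \<and> (\<forall>w\<in>W. \<not> (p w \<in> F \<and> q w \<in> F))} * 4 ^ card W \<le> 3 ^ card W * 2 ^ card E"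
  using assms
proof (induction W arbitrary: E rule: finite_induct)
  case empty
  have "{F. F \<subseteq> E} = Pow E" by auto
  with empty show ?case by (simp add: card_Pow)
next
  case (insert w W)
  define E' where "E' = E - {p w, q w}"
  define S where "S = {F. F \<subseteq> E' \<and> (\<forall>w\<in>W. \<not> (p w \<in> F \<and> q w \<in> F))}"
  define T where "T = {F. F \<subseteq> E \<and> (\<forall>w\<in>insert w W. \<not> (p w \<in> F \<and> q w \<in> F))}"
  have pq: "p w \<noteq> q w" "p w \<in> E" "q w \<in> E"
    using insert.prems by auto
  have "card {p w, q w} = 2"
    using pq by simp
  then have cardE: "card E = card E' + 2"
    using pq insert.prems(1) card_mono[of E "{p w, q w}"] unfolding E'_def
    by (subst card_Diff_subset) auto
  have "finite E'"
    using insert.prems(1) by (simp add: E'_def)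
  have inj: "inj_on p W" "inj_on q W" "p w \<notin> p ` W" "q w \<notin> q ` W"
    using insert.prems(2,3) insert.hyps(2) by simp_all
  have disj: "p ` W \<inter> q ` W = {}" "p w \<notin> q ` W" "q w \<notin> p ` W"
    using insert.prems(4) by blast+
  have "p ` W \<union> q ` W \<subseteq> E'"
    using insert.prems(5) inj disj unfolding E'_def by blast
  then have IH: "card S * 4 ^ card W \<le> 3 ^ card W * 2 ^ card E'"
    unfolding S_def by (intro insert.IH \<open>finite E'\<close> inj disj)
  have finS: "finite S"
    unfolding S_def by (rule finite_subset[of _ "Pow E'"]) (use \<open>finite E'\<close> in auto)
  \<comment> \<open>\<open>F\<close> is recovered from its part in \<open>E'\<close> and its trace
    on {p w, q w}; the full pair is the one excluded trace.\<close>
  have "card T \<le> card (S \<times> {{}, {p w}, {q w}})"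
  proof (rule card_inj_on_le[where f = "\<lambda>F. (F \<inter> E', F \<inter> {p w, q w})"])
    show "inj_on (\<lambda>F. (F \<inter> E', F \<inter> {p w, q w})) T"
    proof (rule inj_onI)
      fix F G assume FG: "F \<in> T" "G \<in> T" "(F \<inter> E', F \<inter> {p w, q w}) = (G \<inter> E', G \<inter> {p w, q w})"
      have "F = (F \<inter> E') \<union> (F \<inter> {p w, q w})" "G = (G \<inter> E') \<union> (G \<inter> {p w, q w})"
        using FG(1,2) unfolding T_def E'_def by auto
      with FG(3) show "F = G" by (metis prod.inject)
    qed
    show "(\<lambda>F. (F \<inter> E', F \<inter> {p w, q w})) ` T \<subseteq> S \<times> {{}, {p w}, {q w}}"
      unfolding S_def T_def by auto
  qed (use finS in simp)
  also have "\<dots> \<le> 3 * card S"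
    using finS pq by (simp add: card_cartesian_product)
  finally have "card T * 4 ^ card (insert w W) \<le> 3 * card S * 4 ^ card (insert w W)"
    by simp
  also have "\<dots> = 12 * (card S * 4 ^ card W)"
    using insert.hyps by simp
  also have "\<dots> \<le> 12 * (3 ^ card W * 2 ^ card E')"
    using IH by simp
  also have "\<dots> = 3 ^ card (insert w W) * 2 ^ card E"
    using insert.hyps by (simp add: cardE)
  finally show ?case unfolding T_def .
qed

subsection \<open>Degrees and common neighbours in random graphs\<close>

lemma PR_edge_index:
  assumes "PR f" "PR g" "PR h"
  shows "PR (\<lambda>e. edge_index (f e) (g e) (h e))"
proof (rule PR_comp3[of edge_index])
  show "PR (\<lambda>e. edge_index (e 0) (e 1) (e 2))"
    unfolding edge_index_def edge_offset_def by (intro PR_intros)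
qed (fact assms)+

lemma PRP_edges_of:
  assumes "PR f" "PR g" "PR h"
  shows "PRP (\<lambda>e. f e \<in> edges_of (g e) (h e))"
  unfolding edges_of_def mem_Collect_eq by (intro PR_intros assms)

text \<open>Degree above n/2 + n/q with denominators cleared. The bracketing of the counted set
  matches the pattern of \<open>PR_card\<close>.\<close>

definition high_degree :: "nat \<Rightarrow> nat \<Rightarrow> nat set \<Rightarrow> bool" where
  "high_degree q n F \<longleftrightarrow> (\<exists>u<Suc n. 1 \<le> u \<and>
     (q + 2) * n < 2 * q * card {v. v < Suc n \<and> (1 \<le> v \<and> v \<noteq> u \<and> edge_index n u v \<in> F)})"

lemma PRP_high_degree: "PRP (\<lambda>e. high_degree q (e 1) (edges_of (e 1) (e 0)))"
  unfolding high_degree_def by (intro PR_intros PRP_edges_of PR_edge_index)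

text \<open>The left side is exp s times cosh s, and cosh s \<le> 1 + s^2 \<le> exp(s^2).\<close>

lemma one_plus_exp_le:
  fixes s :: real
  assumes "0 \<le> s" "s \<le> 1"
  shows "(1 + exp (2 * s)) / 2 \<le> exp (s + s\<^sup>2)"
proof -
  have "exp s \<le> 1 + s + s\<^sup>2"
    using assms by (intro exp_bound)
  moreover have "exp (- s) \<le> 1 - s + s\<^sup>2"
  proof -
    have "exp (- s) * (1 + s) \<le> exp (- s) * exp s"
      using exp_ge_add_one_self[of s] by (intro mult_left_mono) auto
    also have "\<dots> = 1"
      by (simp add: exp_minus)
    also have "1 \<le> (1 - s + s\<^sup>2) * (1 + s)"
      using assms by (simp add: algebra_simps power2_eq_square)
    finally show ?thesis
      using assms by (simp add: mult_le_cancel_right)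
  qed
  ultimately have "(exp s + exp (- s)) / 2 \<le> 1 + s\<^sup>2"
    by simp
  also have "\<dots> \<le> exp (s\<^sup>2)"
    by (rule exp_ge_add_one_self)
  finally have "exp s * ((exp s + exp (- s)) / 2) \<le> exp s * exp (s\<^sup>2)"
    by (rule mult_left_mono) simp
  then show ?thesis
    by (simp add: distrib_left mult_exp_exp add.commute)
qed

lemma finite_subsets_Collect [simp]: "finite E \<Longrightarrow> finite {F. F \<subseteq> E \<and> P F}"
  by (rule finite_subset[of _ "Pow E"]) auto

lemma card_high_degree_le:
  assumes "q \<ge> 1" "n \<ge> 1"
  shows "real (card {F. F \<subseteq> {..<n * (n - 1) div 2} \<and> high_degree q n F}) \<le>
    real n * 2 ^ (n * (n - 1) div 2) * exp (- real n / (real q)\<^sup>2)"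
proof -
  define N where "N = n * (n - 1) div 2"
  define s where "s = 1 / real q"
  \<comment> \<open>The exponential parameter is 2s, and \<open>a\<close> is 2s times the degree
    threshold n/2 + ns. The moment costs at most n(s + s^2) in the exponent, so -n s^2
    remains.\<close>
  define a where "a = real n * (s + 2 * s\<^sup>2)"
  define A where "A u = edge_index n u ` ({1..n} - {u})" for u
  define S where "S u = {F. F \<subseteq> {..<N} \<and> a \<le> 2 * s * real (card (F \<inter> A u))}" for u
  have s: "0 < s" "s \<le> 1"
    using assms by (simp_all add: s_def)
  have inj: "inj_on (edge_index n u) ({1..n} - {u})" if "u \<in> {1..n}" for u
    using that by (intro inj_onI) (metis Diff_iff edge_index_inject singletonI)
  have sub: "{F. F \<subseteq> {..<N} \<and> high_degree q n F} \<subseteq> (\<Union>u\<in>{1..n}. S u)"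
  proof
    fix F assume "F \<in> {F. F \<subseteq> {..<N} \<and> high_degree q n F}"
    then obtain u where F: "F \<subseteq> {..<N}" and u: "u \<in> {1..n}" and
      deg: "(q + 2) * n < 2 * q * card {v. v < Suc n \<and> (1 \<le> v \<and> v \<noteq> u \<and> edge_index n u v \<in> F)}"
      unfolding high_degree_def by (auto simp: less_Suc_eq_le simp del: One_nat_def add_2_eq_Suc')
    let ?D = "{v. v < Suc n \<and> (1 \<le> v \<and> v \<noteq> u \<and> edge_index n u v \<in> F)}"
    have "F \<inter> A u = edge_index n u ` ?D"
      unfolding A_def by auto
    moreover have "inj_on (edge_index n u) ?D"
      by (rule inj_on_subset[OF inj[OF u]]) auto
    ultimately have "card ?D = card (F \<inter> A u)"
      by (simp add: card_image)
    then have "real ((q + 2) * n) \<le> real (2 * q * card (F \<inter> A u))"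
      using deg by (simp only: of_nat_le_iff)
    then have "s\<^sup>2 * ((real q + 2) * real n) \<le> s\<^sup>2 * (2 * real q * real (card (F \<inter> A u)))"
      by (intro mult_left_mono) (auto simp: distrib_right)
    moreover have "s\<^sup>2 * ((real q + 2) * real n) = a"
      using assms by (simp add: a_def s_def field_simps power2_eq_square)
    moreover have "s\<^sup>2 * (2 * real q * real (card (F \<inter> A u))) = 2 * s * real (card (F \<inter> A u))"
      using assms by (simp add: s_def field_simps power2_eq_square)
    ultimately show "F \<in> (\<Union>u\<in>{1..n}. S u)"
      using F u by (auto simp: S_def)
  qed
  have S_le: "real (card (S u)) \<le> 2 ^ N * exp (- real n * s\<^sup>2)" if u: "u \<in> {1..n}" for u
  proof -
    have A: "A u \<subseteq> {..<N}" "card (A u) = n - 1"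
      using u edge_index_less[OF u] card_image[OF inj[OF u]] by (fastforce simp: A_def N_def)+
    then have le: "n - 1 \<le> N"
      using card_mono[of "{..<N}" "A u"] by simp
    have "real (card (S u)) * exp a \<le> (1 + exp (2 * s)) ^ (n - 1) * 2 ^ (N - (n - 1))"
      using card_subsets_exp_le[OF finite_lessThan A(1), of a "2 * s"] by (simp add: S_def A(2))
    also have "\<dots> = ((1 + exp (2 * s)) / 2) ^ (n - 1) * 2 ^ N"
      using le by (simp add: power_divide power_diff)
    \<comment> \<open>Node \<open>u\<close> has only n - 1 possible edges. Raising the exponent to n
      is harmless, the base being at least 1, and lets the terms combine with
      \<open>a\<close>.\<close>
    also have "\<dots> \<le> exp (s + s\<^sup>2) ^ n * 2 ^ N"
    proof (rule mult_right_mono)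
      have "((1 + exp (2 * s)) / 2) ^ (n - 1) \<le> exp (s + s\<^sup>2) ^ (n - 1)"
        using one_plus_exp_le[of s] s by (intro power_mono) (auto simp: add_nonneg_nonneg)
      also have "\<dots> \<le> exp (s + s\<^sup>2) ^ n"
        using s by (intro power_increasing) auto
      finally show "((1 + exp (2 * s)) / 2) ^ (n - 1) \<le> exp (s + s\<^sup>2) ^ n" .
    qed simp
    also have "exp (s + s\<^sup>2) ^ n = exp (- real n * s\<^sup>2) * exp a"
      by (simp add: a_def exp_of_nat_mult[symmetric] mult_exp_exp algebra_simps)
    finally have "real (card (S u)) * exp a \<le> (2 ^ N * exp (- real n * s\<^sup>2)) * exp a"
      by (simp only: mult.commute mult.left_commute)
    then show ?thesis
      by (simp only: mult_le_cancel_right) (simp add: not_less)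
  qed
  have "real (card {F. F \<subseteq> {..<N} \<and> high_degree q n F}) \<le> real (card (\<Union>u\<in>{1..n}. S u))"
    using sub by (intro of_nat_mono card_mono) (auto simp: S_def)
  also have "\<dots> \<le> real (\<Sum>u\<in>{1..n}. card (S u))"
    by (intro of_nat_mono card_UN_le) simp
  also have "\<dots> \<le> (\<Sum>u\<in>{1..n}. 2 ^ N * exp (- real n * s\<^sup>2))"
    unfolding of_nat_sum by (rule sum_mono) (rule S_le)
  also have "\<dots> = real n * 2 ^ N * exp (- real n / (real q)\<^sup>2)"
    by (simp add: s_def power_one_over divide_inverse power_inverse)
  finally show ?thesis unfolding N_def .
qed

text \<open>A graph with a high degree would save n / (q^2 ln 2) bits, which eventually exceeds c
  log n for the randomness deficiency, log n for the choice of \<open>u\<close>, and the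
  constant.\<close>

lemma random_graph_degree_le:
  assumes "universal U" "q \<ge> 1"
  shows "\<forall>\<^sub>F n in sequentially. \<forall>adj. random_graph U n (c * log 2 (real n)) adj \<longrightarrow>
    (\<forall>u\<in>{1..n}. 2 * q * deg adj u \<le> (q + 2) * n)"
proof -
  obtain c' where c': "\<And>n adj \<delta>. random_graph U n \<delta> adj \<and>
      high_degree q n (edges_of n (nat_of_bits (edge_code n adj))) \<Longrightarrow>
    0 < card {F. F \<subseteq> {..<n * (n - 1) div 2} \<and> high_degree q n F} \<and>
    real (n * (n - 1) div 2) - \<delta> \<le>
      log 2 (real (card {F. F \<subseteq> {..<n * (n - 1) div 2} \<and> high_degree q n F})) + real c'"
    using card_random_graph_code[OF assms(1) PRP_high_degree] by blast
  have "0 < real q"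
    using assms(2) by simp
  then have "\<forall>\<^sub>F n in sequentially. (c + 1) * log 2 (real n) + real c' < real n / ((real q)\<^sup>2 * ln 2)"
    by real_asymp
  moreover have "\<forall>\<^sub>F n in sequentially. n \<ge> (1::nat)"
    by (rule eventually_ge_at_top)
  ultimately show ?thesis
  proof eventually_elim
    case (elim n)
    show ?case
    proof (intro allI impI ballI, rule ccontr)
      fix adj u
      let ?k = "card {F. F \<subseteq> {..<n * (n - 1) div 2} \<and> high_degree q n F}"
      assume G: "random_graph U n (c * log 2 (real n)) adj" and u: "u \<in> {1..n}"
        and deg: "\<not> 2 * q * deg adj u \<le> (q + 2) * n"
      have adj: "graph_on n adj"
        using G by (simp add: random_graph_def)
      have "{v. v < Suc n \<and> (1 \<le> v \<and> v \<noteq> u \<and>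
          edge_index n u v \<in> edges_of n (nat_of_bits (edge_code n adj)))} = {v. adj u v}"
        using edges_of_edge_code[OF adj u] adj u unfolding graph_on_def
        by (auto simp: less_Suc_eq_le)
      then have "high_degree q n (edges_of n (nat_of_bits (edge_code n adj)))"
        using deg u unfolding high_degree_def Defs.deg_def by (intro exI[of _ u]) auto
      with c' G have pos: "0 < ?k"
        and le: "real (n * (n - 1) div 2) - c * log 2 (real n) \<le> log 2 (real ?k) + real c'"
        by blast+
      have "log 2 (real ?k) \<le> log 2 (real n * 2 ^ (n * (n - 1) div 2) * exp (- real n / (real q)\<^sup>2))"
        using pos elim(2) card_high_degree_le[OF assms(2) elim(2)] by (intro log_mono) auto
      also have "\<dots> = log 2 (real n) + real (n * (n - 1) div 2) - real n / ((real q)\<^sup>2 * ln 2)"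
        using elim(2) by (simp add: log_mult log_nat_power log_exp)
      finally show False
        using le elim(1) by (simp add: algebra_simps)
    qed
  qed
qed

text \<open>The guards on \<open>w\<close> matter: \<open>edge_index n u u\<close> is no loop but
  coincides with the position of a genuine edge or of the next row.\<close>

definition uncovered :: "nat \<Rightarrow> nat \<Rightarrow> nat set \<Rightarrow> bool" where
  "uncovered M n F \<longleftrightarrow> (\<exists>u<Suc n. \<exists>v<Suc n. 1 \<le> u \<and> 1 \<le> v \<and> u \<noteq> v \<and>
     \<not> (\<exists>w<Suc M. 1 \<le> w \<and> w \<noteq> u \<and> w \<noteq> v \<and> edge_index n u w \<in> F \<and> edge_index n w v \<in> F))"

text \<open>For n \<ge> 1 this is the floor of log n plus 1, written as a count so that the decoders
  can compute it.\<close>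

definition lg :: "nat \<Rightarrow> nat" where
  "lg n = card {i. i < n \<and> 2 ^ i \<le> n}"

text \<open>Three candidates fail together in a fraction (3/4)^3 < 1/2 of the graphs, so 3 K lg n of
  them push the failure below n^(-K). The extra 2 makes up for \<open>u\<close> and
  \<open>v\<close>, which are no candidates themselves.\<close>

definition cover :: "nat \<Rightarrow> nat \<Rightarrow> nat" where
  "cover K n = 3 * K * lg n + 2"

lemma PR_cover: "PR f \<Longrightarrow> PR (\<lambda>e. cover K (f e))"
proof (rule PR_comp1[of "cover K"])
  show "PR (\<lambda>e. cover K (e 0))"
    unfolding cover_def lg_def by (intro PR_intros)
qed

lemma PRP_uncovered: "PRP (\<lambda>e. uncovered (cover K (e 1)) (e 1) (edges_of (e 1) (e 0)))"
  unfolding uncovered_def by (intro PR_intros PRP_edges_of PR_edge_index PR_cover)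

lemma lg_bounds:
  assumes "n \<ge> 1"
  shows "log 2 (real n) \<le> real (lg n)" "real (lg n) \<le> log 2 (real n) + 1"
proof -
  define k where "k = nat \<lfloor>log 2 (real n)\<rfloor>"
  have log: "0 \<le> log 2 (real n)"
    using assms by simp
  have pow: "2 ^ i \<le> n \<longleftrightarrow> i \<le> k" for i
  proof -
    have "2 ^ i \<le> n \<longleftrightarrow> 2 powr real i \<le> real n"
      by (metis numeral_power_le_of_nat_cancel_iff of_nat_numeral powr_realpow zero_less_numeral)
    also have "\<dots> \<longleftrightarrow> real i \<le> log 2 (real n)"
      using assms by (subst le_log_iff) auto
    also have "\<dots> \<longleftrightarrow> i \<le> k"
      unfolding k_def using log by (simp add: le_nat_iff le_floor_iff)
    finally show ?thesis .
  qed
  have "i < n" if "2 ^ i \<le> n" for i :: nat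
    using that less_exp[of i] by linarith
  then have "{i. i < n \<and> 2 ^ i \<le> n} = {..k}"
    using pow by auto
  then have "lg n = Suc k"
    by (simp add: lg_def)
  then have "real (lg n) = of_int \<lfloor>log 2 (real n)\<rfloor> + 1"
    using log by (simp add: k_def)
  then show "log 2 (real n) \<le> real (lg n)" "real (lg n) \<le> log 2 (real n) + 1"
    by linarith+
qed

text \<open>For fixed \<open>u\<close> and \<open>v\<close> the edge pairs {u,w}, {w,v} are disjoint
  for different \<open>w\<close>, and at least M - 2 values of \<open>w\<close> remain. The factor
  n^2 is the union over pairs of nodes.\<close>

lemma card_uncovered_le:
  assumes "M \<le> n"
  shows "real (card {F. F \<subseteq> {..<n * (n - 1) div 2} \<and> uncovered M n F}) \<le>
    real n * real n * 2 ^ (n * (n - 1) div 2) * (3 / 4) ^ (M - 2)"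
proof -
  define N where "N = n * (n - 1) div 2"
  define P where "P = {(u, v). u \<in> {1..n} \<and> v \<in> {1..n} \<and> u \<noteq> v}"
  define S where "S = (\<lambda>(u, v). {F. F \<subseteq> {..<N} \<and>
    (\<forall>w\<in>{1..M} - {u, v}. \<not> (edge_index n u w \<in> F \<and> edge_index n w v \<in> F))})"
  have "P \<subseteq> {1..n} \<times> {1..n}"
    by (auto simp: P_def)
  then have P: "finite P" "card P \<le> n * n"
    using card_mono[of "{1..n} \<times> {1..n}" P] finite_subset[of P "{1..n} \<times> {1..n}"]
    by (simp_all add: card_cartesian_product)
  have sub: "{F. F \<subseteq> {..<N} \<and> uncovered M n F} \<subseteq> (\<Union>uv\<in>P. S uv)"
  proof
    fix F assume F: "F \<in> {F. F \<subseteq> {..<N} \<and> uncovered M n F}"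
    then obtain u v where uv: "u < Suc n" "v < Suc n" "1 \<le> u" "1 \<le> v" "u \<noteq> v"
      and no: "\<not> (\<exists>w<Suc M. 1 \<le> w \<and> w \<noteq> u \<and> w \<noteq> v \<and> edge_index n u w \<in> F \<and> edge_index n w v \<in> F)"
      unfolding uncovered_def by blast
    have "F \<in> S (u, v)"
      using F no unfolding S_def prod.case by (auto simp: less_Suc_eq_le)
    moreover have "(u, v) \<in> P"
      using uv by (simp add: P_def)
    ultimately show "F \<in> (\<Union>uv\<in>P. S uv)"
      by blast
  qed
  have S_le: "real (card (S uv)) \<le> 2 ^ N * (3 / 4) ^ (M - 2)" if "uv \<in> P" for uv
  proof -
    obtain u v where uv: "uv = (u, v)" "u \<in> {1..n}" "v \<in> {1..n}" "u \<noteq> v"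
      using \<open>uv \<in> P\<close> unfolding P_def by blast
    define W where "W = {1..M} - {u, v}"
    have W: "w \<in> {1..n}" "w \<noteq> u" "w \<noteq> v" if "w \<in> W" for w
      using that assms by (auto simp: W_def)
    have "M - 2 \<le> card W"
      unfolding W_def using diff_card_le_card_Diff[of "{u, v}" "{1..M}"] uv by simp
    have "card (S uv) * 4 ^ card W \<le> 3 ^ card W * 2 ^ card {..<N}"
      unfolding S_def uv prod.case W_def[symmetric]
    proof (rule card_avoiding_pairs_le)
      show "inj_on (edge_index n u) W"
        by (rule inj_onI) (metis W edge_index_inject uv(2))
      show "inj_on (\<lambda>w. edge_index n w v) W"
        by (rule inj_onI) (metis W edge_index_inject uv(3))
      show "edge_index n u ` W \<inter> (\<lambda>w. edge_index n w v) ` W = {}"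
      proof (rule ccontr)
        assume "edge_index n u ` W \<inter> (\<lambda>w. edge_index n w v) ` W \<noteq> {}"
        then obtain w w' where "w \<in> W" "w' \<in> W" "edge_index n u w = edge_index n w' v"
          by auto
        with edge_index_inject[of u n w w' v] W uv show False by metis
      qed
      show "edge_index n u ` W \<union> (\<lambda>w. edge_index n w v) ` W \<subseteq> {..<N}"
        using edge_index_less[OF uv(2) W(1)] edge_index_less[OF W(1) uv(3)] W
        unfolding N_def by blast
    qed (auto simp: W_def)
    then have "real (card (S uv) * 4 ^ card W) \<le> real (3 ^ card W * 2 ^ N)"
      by (simp only: of_nat_le_iff card_lessThan)
    then have "real (card (S uv)) \<le> 2 ^ N * (3 / 4) ^ card W"
      by (simp add: power_divide field_simps)
    also have "\<dots> \<le> 2 ^ N * (3 / 4) ^ (M - 2)"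
      using \<open>M - 2 \<le> card W\<close> by (intro mult_left_mono power_decreasing) auto
    finally show ?thesis .
  qed
  have "real (card {F. F \<subseteq> {..<N} \<and> uncovered M n F}) \<le> real (card (\<Union>uv\<in>P. S uv))"
    using sub P(1) by (intro of_nat_mono card_mono) (auto simp: S_def)
  also have "\<dots> \<le> real (\<Sum>uv\<in>P. card (S uv))"
    by (intro of_nat_mono card_UN_le P(1))
  also have "\<dots> \<le> (\<Sum>uv\<in>P. 2 ^ N * (3 / 4) ^ (M - 2))"
    unfolding of_nat_sum by (rule sum_mono) (rule S_le)
  also have "\<dots> = real (card P) * (2 ^ N * (3 / 4) ^ (M - 2))"
    by simp
  also have "\<dots> \<le> real (n * n) * (2 ^ N * (3 / 4) ^ (M - 2))"
    using P(2) by (intro mult_right_mono of_nat_mono) auto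
  finally show ?thesis unfolding N_def by (simp add: mult.assoc)
qed

lemma power_cover_le:
  assumes "n \<ge> 1"
  shows "log 2 ((3 / 4) ^ (cover K n - 2)) \<le> - real K * log 2 (real n)"
proof -
  have "(3 / 4 :: real) ^ (cover K n - 2) = (27 / 64) ^ (K * lg n)"
    by (simp add: cover_def mult.assoc power_mult power3_eq_cube)
  also have "\<dots> \<le> (1 / 2) ^ (K * lg n)"
    by (intro power_mono) auto
  finally have "log 2 ((3 / 4) ^ (cover K n - 2)) \<le> log 2 ((1 / 2) ^ (K * lg n))"
    by (intro log_mono) auto
  also have "\<dots> = - real K * real (lg n)"
    by (simp add: log_nat_power log_divide)
  also have "\<dots> \<le> - real K * log 2 (real n)"
    using lg_bounds(1)[OF assms] by (simp add: mult_left_mono)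
  finally show ?thesis .
qed

text \<open>Budget behind c + 3: c log n for the randomness deficiency, 2 log n for the choice of
  (u, v), and one more log n to outgrow the constant.\<close>

lemma random_graph_common_neighbour:
  assumes "universal U" "c + 3 \<le> real K"
  shows "\<forall>\<^sub>F n in sequentially. \<forall>adj. random_graph U n (c * log 2 (real n)) adj \<longrightarrow>
    (\<forall>u\<in>{1..n}. \<forall>v\<in>{1..n}. u \<noteq> v \<longrightarrow> (\<exists>w\<in>{1..cover K n}. adj u w \<and> adj w v))"
proof -
  obtain c' where c': "\<And>n adj \<delta>. random_graph U n \<delta> adj \<and>
      uncovered (cover K n) n (edges_of n (nat_of_bits (edge_code n adj))) \<Longrightarrow>
    0 < card {F. F \<subseteq> {..<n * (n - 1) div 2} \<and> uncovered (cover K n) n F} \<and>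
    real (n * (n - 1) div 2) - \<delta> \<le>
      log 2 (real (card {F. F \<subseteq> {..<n * (n - 1) div 2} \<and> uncovered (cover K n) n F})) + real c'"
    using card_random_graph_code[OF assms(1) PRP_uncovered] by blast
  \<comment> \<open>Guarantees \<open>cover K n\<close> \<le> n, so that all candidates are
    nodes.\<close>
  have "\<forall>\<^sub>F n in sequentially. 3 * real K * (log 2 (real n) + 1) + 2 \<le> real n"
    by real_asymp
  moreover have "\<forall>\<^sub>F n in sequentially. real c' < log 2 (real n)"
    by real_asymp
  moreover have "\<forall>\<^sub>F n in sequentially. n \<ge> (1::nat)"
    by (rule eventually_ge_at_top)
  ultimately show ?thesis
  proof eventually_elim
    case (elim n)
    have "real K * real (lg n) \<le> real K * (log 2 (real n) + 1)"
      using lg_bounds(2)[OF elim(3)] by (intro mult_left_mono) auto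
    then have "real (cover K n) \<le> real n"
      using elim(1) by (simp add: cover_def)
    then have le: "cover K n \<le> n"
      by simp
    show ?case
    proof (intro allI impI ballI, rule ccontr)
      fix adj u v
      let ?k = "card {F. F \<subseteq> {..<n * (n - 1) div 2} \<and> uncovered (cover K n) n F}"
      assume G: "random_graph U n (c * log 2 (real n)) adj" and uv: "u \<in> {1..n}" "v \<in> {1..n}" "u \<noteq> v"
        and not: "\<not> (\<exists>w\<in>{1..cover K n}. adj u w \<and> adj w v)"
      have adj: "graph_on n adj"
        using G by (simp add: random_graph_def)
      let ?F = "edges_of n (nat_of_bits (edge_code n adj))"
      have no_w: "\<not> (edge_index n u w \<in> ?F \<and> edge_index n w v \<in> ?F)"
        if "w < Suc (cover K n)" "1 \<le> w" "w \<noteq> u" "w \<noteq> v" for w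
      proof -
        have w: "w \<in> {1..n}" "w \<in> {1..cover K n}"
          using that le by auto
        show ?thesis
          using edges_of_edge_code[OF adj uv(1) w(1)] edges_of_edge_code[OF adj w(1) uv(2)] that not w(2)
          by blast
      qed
      then have "uncovered (cover K n) n ?F"
        using uv unfolding uncovered_def
        by (intro exI[of _ u] conjI exI[of _ v]) (auto simp del: One_nat_def)
      with c' G have pos: "0 < ?k"
        and ge: "real (n * (n - 1) div 2) - c * log 2 (real n) \<le> log 2 (real ?k) + real c'"
        by blast+
      have "log 2 (real ?k) \<le>
          log 2 (real n * real n * 2 ^ (n * (n - 1) div 2) * (3 / 4) ^ (cover K n - 2))"
        using pos card_uncovered_le[OF le] by (intro log_mono) auto
      also have "\<dots> = 2 * log 2 (real n) + real (n * (n - 1) div 2) + log 2 ((3 / 4) ^ (cover K n - 2))"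
        using elim(3) by (simp add: log_mult log_nat_power)
      also have "\<dots> \<le> 2 * log 2 (real n) + real (n * (n - 1) div 2) - real K * log 2 (real n)"
        using power_cover_le[OF elim(3), of K] by simp
      finally have "(real K - 2 - c) * log 2 (real n) \<le> real c'"
        using ge by (simp add: algebra_simps)
      moreover have "1 * log 2 (real n) \<le> (real K - 2 - c) * log 2 (real n)"
        using assms(2) elim(3) by (intro mult_right_mono) auto
      ultimately show False
        using elim(2) by simp
    qed
  qed
qed

subsection \<open>Shortest path routing\<close>

text \<open>Replaces walks as lists by powers of the adjacency relation, for which composition and
  splitting are available.\<close>

lemma ex_walk_iff_relpowp:
  "(\<exists>xs. is_walk adj xs \<and> length xs = Suc k \<and> hd xs = u \<and> last xs = v) \<longleftrightarrow> (adj ^^ k) u v"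
proof
  assume "\<exists>xs. is_walk adj xs \<and> length xs = Suc k \<and> hd xs = u \<and> last xs = v"
  then obtain xs where "is_walk adj xs" "length xs = Suc k" "hd xs = u" "last xs = v"
    by blast
  then show "(adj ^^ k) u v"
    unfolding relpowp_fun_conv
    by (intro exI[of _ "(!) xs"]) (auto simp: is_walk_def hd_conv_nth last_conv_nth)
next
  assume "(adj ^^ k) u v"
  then obtain f where "f 0 = u" "f k = v" "\<forall>i<k. adj (f i) (f (Suc i))"
    unfolding relpowp_fun_conv by blast
  then show "\<exists>xs. is_walk adj xs \<and> length xs = Suc k \<and> hd xs = u \<and> last xs = v"
    by (intro exI[of _ "map f [0..<Suc k]"])
      (auto simp: is_walk_def hd_map last_map nth_append simp del: upt_Suc)
qed

lemma gdist_eq_Least: "gdist adj u v = (LEAST k. (adj ^^ k) u v)"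
  unfolding gdist_def ex_walk_iff_relpowp ..

lemma reachable_iff: "reachable adj u v \<longleftrightarrow> (\<exists>k. (adj ^^ k) u v)"
proof -
  have "reachable adj u v \<longleftrightarrow>
      (\<exists>k xs. is_walk adj xs \<and> length xs = Suc k \<and> hd xs = u \<and> last xs = v)"
    unfolding reachable_def by (metis Suc_pred is_walk_def length_greater_0_conv)
  then show ?thesis unfolding ex_walk_iff_relpowp .
qed

lemma relpowp_gdist: "reachable adj u v \<Longrightarrow> (adj ^^ gdist adj u v) u v"
  unfolding gdist_eq_Least reachable_iff by (rule LeastI_ex)

lemma gdist_le: "(adj ^^ k) u v \<Longrightarrow> gdist adj u v \<le> k"
  unfolding gdist_eq_Least by (rule Least_le)

lemma gdist_self [simp]: "gdist adj v v = 0"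
  using gdist_le[of 0 adj v v] by simp

lemma reachable_self [simp]: "reachable adj v v"
  unfolding reachable_iff by (rule exI[of _ 0]) simp

lemma gdist_eq_0_D: "reachable adj u v \<Longrightarrow> gdist adj u v = 0 \<Longrightarrow> u = v"
  using relpowp_gdist[of adj u v] by simp

text \<open>The legal next hops. Reachability is included since \<open>gdist\<close>, a
  \<open>LEAST\<close>, carries no information when no walk exists.\<close>

definition closer :: "(nat \<Rightarrow> nat \<Rightarrow> bool) \<Rightarrow> nat \<Rightarrow> nat \<Rightarrow> nat \<Rightarrow> bool" where
  "closer adj u v w \<longleftrightarrow> adj u w \<and> reachable adj w v \<and> gdist adj u v = Suc (gdist adj w v)"

lemma gdist_step_le:
  assumes "adj u w" "reachable adj w v"
  shows "gdist adj u v \<le> Suc (gdist adj w v)"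
  using relpowp_Suc_I2[OF assms(1) relpowp_gdist[OF assms(2)]] by (rule gdist_le)

lemma ex_closer:
  assumes "reachable adj u v" "u \<noteq> v"
  shows "\<exists>w. closer adj u v w"
proof -
  have "gdist adj u v \<noteq> 0"
    using assms gdist_eq_0_D by blast
  then obtain k where k: "gdist adj u v = Suc k"
    using not0_implies_Suc by blast
  then have "(adj ^^ Suc k) u v"
    using relpowp_gdist[OF assms(1)] by simp
  then obtain w where w: "adj u w" "(adj ^^ k) w v"
    by (blast elim: relpowp_Suc_E2)
  then have "reachable adj w v"
    unfolding reachable_iff by blast
  with w gdist_step_le[OF w(1) this] gdist_le[OF w(2)] k show ?thesis
    unfolding closer_def by (intro exI[of _ w]) simp
qed

lemma reachable_if_closer: "closer adj u v w \<Longrightarrow> reachable adj u v"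
  unfolding closer_def reachable_iff by (metis relpowp_Suc_I2)

lemma closer_adjacent: "adj u v \<Longrightarrow> u \<noteq> v \<Longrightarrow> closer adj u v v"
proof -
  assume uv: "adj u v" "u \<noteq> v"
  then have "reachable adj u v"
    unfolding reachable_iff by (metis relpowp_1)
  then have "gdist adj u v \<noteq> 0"
    using uv gdist_eq_0_D by blast
  moreover have "gdist adj u v \<le> 1"
    using gdist_step_le[of adj u v v] uv by simp
  ultimately show ?thesis
    using uv by (simp add: closer_def)
qed

text \<open>The walk through \<open>w\<close> has length 2, and nothing shorter exists: the first
  hop of a shortest walk cannot be \<open>v\<close> itself, as \<open>u\<close> and \<open>v\<close>
  are not adjacent.\<close>

lemma closer_common_neighbour:
  assumes "adj u w" "adj w v" "\<not> adj u v" "u \<noteq> v"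
  shows "closer adj u v w"
proof -
  have wv: "w \<noteq> v"
    using assms by blast
  have dist: "reachable adj w v" "gdist adj w v = 1"
    using closer_adjacent[of adj w v] assms(2) wv reachable_if_closer[of adj w v v]
    by (simp_all add: closer_def)
  then have "gdist adj u v \<le> 2"
    using gdist_step_le[OF assms(1) dist(1)] by simp
  moreover have "reachable adj u v"
    using assms(1) dist(1) unfolding reachable_iff by (metis relpowp_Suc_I2)
  then obtain w' where w': "adj u w'" "reachable adj w' v" "gdist adj u v = Suc (gdist adj w' v)"
    using ex_closer[of adj u v] assms(4) unfolding closer_def by blast
  then have "gdist adj w' v \<noteq> 0"
    using gdist_eq_0_D assms(3) by blast
  ultimately show ?thesis
    using w' dist assms(1) by (simp add: closer_def)
qed

lemma port_le_deg:
  assumes "port_assignment n adj port" "u \<in> {1..n}" "adj u w"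
  shows "port u w \<in> {1..deg adj u}"
  using assms unfolding port_assignment_def bij_betw_def by blast

lemma nbr_port:
  assumes "port_assignment n adj port" "u \<in> {1..n}" "adj u w"
  shows "nbr adj port u (port u w) = w"
proof -
  have "inj_on (port u) {w. adj u w}"
    using assms(1,2) unfolding port_assignment_def bij_betw_def by blast
  then have "adj u w' \<and> port u w' = port u w \<longleftrightarrow> w' = w" for w'
    using assms(3) by (auto dest: inj_onD)
  then show ?thesis
    unfolding nbr_def by simp
qed

text \<open>Every hop lowers the distance to \<open>v\<close> by exactly one, so remaining distance
  plus hops made is invariant; the message arrives after \<open>gdist\<close> hops and not
  earlier.\<close>

lemma shortest_path_schemeI:
  assumes G: "graph_on n adj" and port: "port_assignment n adj port"
    and hop: "\<And>u v. u \<in> {1..n} \<Longrightarrow> v \<in> {1..n} \<Longrightarrow> u \<noteq> v \<Longrightarrow> reachable adj u v \<Longrightarrow>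
      closer adj u v (hop u v) \<and> R u v = port u (hop u v)"
  shows "shortest_path_scheme n adj port R"
  unfolding shortest_path_scheme_def
proof (intro ballI impI)
  fix u v assume uv: "u \<in> {1..n}" "v \<in> {1..n}" "u \<noteq> v \<and> reachable adj u v"
  let ?r = "route adj port R u v"
  have step: "?r (Suc k) = hop (?r k) v" "adj (?r k) (hop (?r k) v)"
    if "?r k \<in> {1..n}" "?r k \<noteq> v" "reachable adj (?r k) v" for k
    using hop[OF that(1) uv(2) that(2,3)] nbr_port[OF port that(1)] that(2)
    by (auto simp: closer_def)
  have inv: "?r k \<in> {1..n} \<and> reachable adj (?r k) v \<and> gdist adj (?r k) v + k = gdist adj u v"
    if "k \<le> gdist adj u v" for k
    using that
  proof (induction k)
    case (Suc k)
    then have IH: "?r k \<in> {1..n}" "reachable adj (?r k) v" "gdist adj (?r k) v + k = gdist adj u v"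
      by simp_all
    then have ne: "?r k \<noteq> v"
      using Suc.prems by auto
    have "closer adj (?r k) v (hop (?r k) v)"
      using hop[OF IH(1) uv(2) ne IH(2)] by simp
    moreover have "hop (?r k) v \<in> {1..n}"
      using step(2)[OF IH(1) ne IH(2)] G unfolding graph_on_def by blast
    ultimately show ?case
      using IH step(1)[OF IH(1) ne IH(2)] by (simp add: closer_def)
  qed (use uv in simp)
  have "R u v \<in> {1..deg adj u}"
    using hop[OF uv(1,2)] uv port_le_deg[OF port uv(1)] by (auto simp: closer_def)
  moreover have "?r (gdist adj u v) = v"
    using inv[OF order_refl] gdist_eq_0_D[of adj "?r (gdist adj u v)" v] by simp
  moreover have "?r k \<noteq> v \<and> adj (?r k) (?r (Suc k))" if "k < gdist adj u v" for k
  proof -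
    have "?r k \<noteq> v"
      using inv[of k] that by auto
    then show ?thesis
      using inv[of k] that step[of k] by simp
  qed
  ultimately show "R u v \<in> {1..deg adj u} \<and> ?r (gdist adj u v) = v \<and>
      (\<forall>k<gdist adj u v. ?r k \<noteq> v \<and> adj (?r k) (?r (Suc k)))"
    by blast
qed

subsection \<open>Encoding of routing tables\<close>

definition digit :: "nat \<Rightarrow> nat \<Rightarrow> nat \<Rightarrow> nat" where
  "digit b m i = m div b ^ i mod b"

lemma PR_digit: "PR f \<Longrightarrow> PR g \<Longrightarrow> PR h \<Longrightarrow> PR (\<lambda>e. digit (f e) (g e) (h e))"
  unfolding digit_def by (intro PR_intros)

text \<open>The quotient \<open>h\<close> is left free so that a number in another base can be
  stacked on top of the digits: the sizes multiply and no separator is spent.\<close>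

lemma ex_digits:
  assumes "\<And>i. i < k \<Longrightarrow> a i < b"
  shows "\<exists>m. (\<forall>i<k. digit b m i = a i) \<and> m div b ^ k = h \<and> m < b ^ k * Suc h"
  using assms
proof (induction k arbitrary: a)
  case 0
  show ?case by (rule exI[of _ h]) simp
next
  case (Suc k)
  obtain m where m: "\<forall>i<k. digit b m i = a (Suc i)" "m div b ^ k = h" "m < b ^ k * Suc h"
    using Suc.IH[of "\<lambda>i. a (Suc i)"] Suc.prems by auto
  have a0: "a 0 < b"
    using Suc.prems by simp
  then have div: "(a 0 + b * m) div b = m"
    by simp
  have "digit b (a 0 + b * m) i = a i" if "i < Suc k" for i
  proof (cases i)
    case (Suc j)
    then show ?thesis
      using m(1) that by (simp add: digit_def div_mult2_eq div)
  qed (use a0 in \<open>simp add: digit_def\<close>)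
  moreover have "(a 0 + b * m) div b ^ Suc k = h"
    by (simp add: div_mult2_eq div m(2))
  moreover have "a 0 + b * m < b ^ Suc k * Suc h"
  proof -
    have "a 0 + b * m < b * Suc m"
      using a0 by simp
    also have "\<dots> \<le> b * (b ^ k * Suc h)"
      using m(3) by (intro mult_le_mono2) simp
    finally show ?thesis by (simp only: power_Suc mult.assoc)
  qed
  ultimately show ?case by blast
qed

text \<open>The low digits of \<open>m\<close>, in base \<open>Suc M\<close>, hold one digit per destination. The high digits,
  in base \<open>Suc n\<close>, list the table entries of the destinations with low digit 0; a destination with
  low digit \<open>Suc r\<close> shares the \<open>r\<close>-th of them.\<close>
definition table_entry :: "nat \<Rightarrow> nat \<Rightarrow> nat \<Rightarrow> nat \<Rightarrow> nat" where
  "table_entry M n m p = digit (Suc n) (m div Suc M ^ (n - 1))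
     (if digit (Suc M) m p = 0 then card {j. j < p \<and> digit (Suc M) m j = 0}
      else digit (Suc M) m p - 1)"

definition decode_table :: "nat \<Rightarrow> nat \<Rightarrow> nat \<Rightarrow> nat" where
  "decode_table M n m = list_encode (map (table_entry M n m) [0..<n - 1])"

lemma PR_decode_table:
  assumes "PR f" "PR g" "PR h"
  shows "PR (\<lambda>e. decode_table (f e) (g e) (h e))"
proof (rule PR_comp3[of decode_table])
  show "PR (\<lambda>e. decode_table (e 0) (e 1) (e 2))"
    unfolding decode_table_def table_entry_def
    by (intro PR_list_encode PR_digit PR_intros)
qed (fact assms)+

text \<open>The low digits reveal which positions own an entry, hence also the rank of each of them;
  so the owned entries can be listed without their positions.\<close>

lemma ex_decode_table:
  fixes idx :: "nat \<Rightarrow> nat"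
  defines "rank \<equiv> \<lambda>p. card {j. j < p \<and> idx j = 0}"
  assumes len: "length ts = n - 1"
    and ts: "\<And>p. p < n - 1 \<Longrightarrow> ts ! p \<le> n"
    and idx: "\<And>p. p < n - 1 \<Longrightarrow> idx p \<le> M"
    and shared: "\<And>p. p < n - 1 \<Longrightarrow> idx p \<noteq> 0 \<Longrightarrow>
      \<exists>j<n - 1. idx j = 0 \<and> rank j = idx p - 1 \<and> ts ! j = ts ! p"
  shows "\<exists>m. decode_table M n m = list_encode ts \<and>
    Suc m \<le> Suc M ^ (n - 1) * Suc n ^ card {p. p < n - 1 \<and> idx p = 0}"
proof -
  let ?Z = "{p. p < n - 1 \<and> idx p = 0}"
  have rank_less: "rank p < rank p'" if "p < p'" "idx p = 0" for p p'
    unfolding rank_def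
  proof (rule psubset_card_mono)
    show "{j. j < p \<and> idx j = 0} \<subset> {j. j < p' \<and> idx j = 0}"
      using that by auto
  qed simp
  then have rank_inj: "p = p'" if "idx p = 0" "idx p' = 0" "rank p = rank p'" for p p'
    using that by (metis less_irrefl linorder_neqE_nat)
  have rank_card: "rank p < card ?Z" if "p < n - 1" "idx p = 0" for p
    unfolding rank_def
  proof (rule psubset_card_mono)
    show "{j. j < p \<and> idx j = 0} \<subset> ?Z"
      using that by auto
  qed simp
  define a where "a r = ts ! (THE p. p < n - 1 \<and> idx p = 0 \<and> rank p = r)" for r
  have a_rank: "a (rank p) = ts ! p" if "p < n - 1" "idx p = 0" for p
  proof -
    have "(THE p'. p' < n - 1 \<and> idx p' = 0 \<and> rank p' = rank p) = p"
      by (rule the_equality) (use that rank_inj in auto)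
    then show ?thesis by (simp add: a_def)
  qed
  \<comment> \<open>Replacing oversized values by 0 makes every digit legal without proving that
    each \<open>r\<close> is the rank of some position. The top quotient 0 gives the bound with
    factor 1.\<close>
  obtain h where h: "\<forall>r<card ?Z. digit (Suc n) h r = (if a r \<le> n then a r else 0)" "h < Suc n ^ card ?Z"
    using ex_digits[of "card ?Z" "\<lambda>r. if a r \<le> n then a r else 0" "Suc n" 0] by fastforce
  then have digit_h: "digit (Suc n) h (rank p) = ts ! p" if "p < n - 1" "idx p = 0" for p
    using rank_card[OF that] a_rank[OF that] ts[OF that(1)] by simp
  obtain m where m: "\<forall>p<n - 1. digit (Suc M) m p = idx p" "m div Suc M ^ (n - 1) = h"
      "m < Suc M ^ (n - 1) * Suc h"
    using ex_digits[of "n - 1" idx "Suc M" h] idx by (auto simp: less_Suc_eq_le)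
  have entry: "table_entry M n m p = ts ! p" if p: "p < n - 1" for p
  proof -
    have "{j. j < p \<and> digit (Suc M) m j = 0} = {j. j < p \<and> idx j = 0}"
      using m(1) p by auto
    then have *: "table_entry M n m p = digit (Suc n) h (if idx p = 0 then rank p else idx p - 1)"
      using m(1,2) p by (simp add: table_entry_def rank_def)
    show ?thesis
    proof (cases "idx p = 0")
      case True
      then show ?thesis using * digit_h p by simp
    next
      case False
      obtain j where j: "j < n - 1" "idx j = 0" "rank j = idx p - 1" "ts ! j = ts ! p"
        using shared[OF p False] by blast
      with * False digit_h[OF j(1,2)] show ?thesis by simp
    qed
  qed
  then have "map (table_entry M n m) [0..<n - 1] = ts"
    using len by (intro nth_equalityI) auto
  then have "decode_table M n m = list_encode ts"
    by (simp add: decode_table_def)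
  moreover have "Suc m \<le> Suc M ^ (n - 1) * Suc n ^ card ?Z"
  proof -
    have "Suc m \<le> Suc M ^ (n - 1) * Suc h"
      using m(3) by simp
    also have "\<dots> \<le> Suc M ^ (n - 1) * Suc n ^ card ?Z"
      using h(2) by (intro mult_le_mono2) simp
    finally show ?thesis .
  qed
  ultimately show ?thesis by blast
qed

lemma filter_neq_upt:
  assumes "u \<in> {1..n}"
  shows "filter (\<lambda>v. v \<noteq> u) [1..<Suc n] = [1..<u] @ [Suc u..<Suc n]"
proof -
  have "[1..<Suc n] = [1..<u] @ u # [Suc u..<Suc n]"
    using assms upt_add_eq_append[of 1 u "Suc n - u"] by (simp add: upt_conv_Cons del: upt_Suc)
  then show ?thesis
    by (simp add: filter_id_conv del: upt_Suc)
qed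

text \<open>\<open>S\<close> is the set of destinations whose port is listed: the neighbours in the
  main case, all nodes in the crude bound for small n. The candidate bound costs nothing, since the
  decoder computes \<open>cover K n\<close> from the n in the condition.\<close>

lemma local_size_le:
  assumes "universal U"
  shows "\<exists>c'. \<forall>n u R S. u \<in> {1..n} \<and> finite S \<and> (\<forall>v\<in>{1..n} - {u}. R u v \<le> n) \<and>
      (\<forall>v\<in>{1..n} - {u} - S. \<exists>w\<in>S \<inter> {1..n} - {u}. w \<le> cover K n \<and> R u w = R u v) \<longrightarrow>
    real (local_size U n R u) \<le>
      real c' + real n * log 2 (real (cover K n) + 1) + real (card S) * log 2 (real n + 1)"
proof -
  define D where "D m y = decode_table (cover K (fst (prod_decode y))) (fst (prod_decode y)) m" for m y
  have "PR (\<lambda>e. D (e 0) (e 1))"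
    unfolding D_def by (intro PR_decode_table PR_cover PR_fst_prod_decode PR_var)
  from KC_le_log[OF assms this] obtain c' where
    c': "real (KC U (bits_of_nat (D m y)) (bits_of_nat y)) \<le> log 2 (real (Suc m)) + real c'" for m y
    by blast
  have "real (local_size U n R u) \<le>
      real c' + real n * log 2 (real (cover K n) + 1) + real (card S) * log 2 (real n + 1)"
    if u: "u \<in> {1..n}" and S: "finite S" and R: "\<forall>v\<in>{1..n} - {u}. R u v \<le> n"
      and shared: "\<forall>v\<in>{1..n} - {u} - S. \<exists>w\<in>S \<inter> {1..n} - {u}. w \<le> cover K n \<and> R u w = R u v"
    for n u R S
  proof -
    define M where "M = cover K n"
    define vs where "vs = filter (\<lambda>v. v \<noteq> u) [1..<Suc n]"
    have vs_eq: "vs = [1..<u] @ [Suc u..<Suc n]"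
      unfolding vs_def by (rule filter_neq_upt[OF u])
    have len: "length vs = n - 1"
      using u by (simp add: vs_eq del: upt_Suc)
    have set_vs: "set vs = {1..n} - {u}"
      by (auto simp: vs_def)
    \<comment> \<open>Positions start at 0 and labels at 1. Therefore the rank of \<open>w\<close>
      is at most its position, which is below \<open>w\<close> \<le> \<open>M\<close>, and the rank
      shifted by one is still a digit in base \<open>Suc M\<close>.\<close>
    have vs_ge: "p < vs ! p" if "p < n - 1" for p
      using that u by (auto simp: vs_eq nth_append simp del: upt_Suc)
    have vs_mem: "vs ! p \<in> {1..n} - {u}" if "p < n - 1" for p
      using nth_mem[of p vs] that len set_vs by simp
    define rank where "rank p = card {j. j < p \<and> vs ! j \<in> S}" for p
    have rank_le: "rank p \<le> p" for p
      using card_mono[of "{..<p}" "{j. j < p \<and> vs ! j \<in> S}"] by (auto simp: rank_def)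
    have "\<exists>j<n - 1. vs ! j \<in> S \<and> rank j < M \<and> R u (vs ! j) = R u (vs ! p)"
      if p: "p < n - 1" "vs ! p \<notin> S" for p
    proof -
      obtain w where w: "w \<in> S" "w \<in> {1..n} - {u}" "w \<le> M" "R u w = R u (vs ! p)"
        using shared vs_mem[OF p(1)] p(2) unfolding M_def by blast
      then obtain j where j: "j < n - 1" "vs ! j = w"
        unfolding set_vs[symmetric] using len by (metis in_set_conv_nth)
      then have "rank j < M"
        using rank_le[of j] vs_ge[of j] w(3) by simp
      with j w show ?thesis by blast
    qed
    then obtain g where g: "\<And>p. p < n - 1 \<Longrightarrow> vs ! p \<notin> S \<Longrightarrow>
        g p < n - 1 \<and> vs ! g p \<in> S \<and> rank (g p) < M \<and> R u (vs ! g p) = R u (vs ! p)"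
      by metis
    define idx where "idx p = (if vs ! p \<in> S then 0 else Suc (rank (g p)))" for p
    have idx0: "idx p = 0 \<longleftrightarrow> vs ! p \<in> S" for p
      by (simp add: idx_def)
    define ts where "ts = map (R u) vs"
    have ts: "ts ! p = R u (vs ! p)" if "p < n - 1" for p
      using that len by (simp add: ts_def)
    have "\<exists>m. decode_table M n m = list_encode ts \<and>
        Suc m \<le> Suc M ^ (n - 1) * Suc n ^ card {p. p < n - 1 \<and> idx p = 0}"
    proof (rule ex_decode_table)
      show "length ts = n - 1"
        by (simp add: ts_def len)
      show "ts ! p \<le> n" if "p < n - 1" for p
        using ts[OF that] R vs_mem[OF that] by simp
      show "idx p \<le> M" if "p < n - 1" for p
        using g[OF that] by (auto simp: idx_def)
      show "\<exists>j<n - 1. idx j = 0 \<and> card {i. i < j \<and> idx i = 0} = idx p - 1 \<and> ts ! j = ts ! p"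
        if "p < n - 1" "idx p \<noteq> 0" for p
        using g[OF that(1)] that ts unfolding idx0 rank_def[symmetric]
        by (intro exI[of _ "g p"]) (auto simp: idx_def)
    qed
    then obtain m where m: "decode_table M n m = list_encode ts"
      and m_le: "Suc m \<le> Suc M ^ (n - 1) * Suc n ^ card {p. p < n - 1 \<and> idx p = 0}"
      by blast
    have "card {p. p < n - 1 \<and> idx p = 0} \<le> card S"
    proof (rule card_inj_on_le)
      have "distinct vs"
        by (simp add: vs_def)
      then show "inj_on ((!) vs) {p. p < n - 1 \<and> idx p = 0}"
        using len by (auto simp: inj_on_def nth_eq_iff_index_eq)
    qed (use S in \<open>auto simp: idx0\<close>)
    then have "Suc M ^ (n - 1) * Suc n ^ card {p. p < n - 1 \<and> idx p = 0} \<le> Suc M ^ n * Suc n ^ card S"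
      by (intro mult_le_mono power_increasing) auto
    then have "Suc m \<le> Suc M ^ n * Suc n ^ card S"
      using m_le by (rule order_trans[rotated])
    then have "real (Suc m) \<le> real (Suc M ^ n * Suc n ^ card S)"
      by (simp only: of_nat_le_iff)
    then have "log 2 (real (Suc m)) \<le> log 2 (real (Suc M ^ n * Suc n ^ card S))"
      by (intro log_mono) auto
    also have "\<dots> = real n * log 2 (real M + 1) + real (card S) * log 2 (real n + 1)"
      by (simp add: log_mult log_nat_power add.commute)
    finally have "log 2 (real (Suc m)) \<le> \<dots>" .
    moreover have "D m (prod_encode (n, u)) = list_encode ts"
      by (simp add: D_def m[unfolded M_def])
    then have "local_size U n R u =
        KC U (bits_of_nat (D m (prod_encode (n, u)))) (bits_of_nat (prod_encode (n, u)))"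
      unfolding local_size_def table_code_def vs_def[symmetric] ts_def by simp
    ultimately show ?thesis
      using c'[of m "prod_encode (n, u)"] unfolding M_def by linarith
  qed
  then show ?thesis by blast
qed

subsection \<open>The upper bound\<close>

text \<open>No randomness here and \<open>M\<close> is arbitrary: the scheme is correct for every
  graph, and entries are shared wherever a common neighbour up to \<open>M\<close> happens to
  exist.\<close>

lemma shortest_path_scheme_small_tables:
  assumes G: "graph_on n adj" and port: "port_assignment n adj port"
  shows "\<exists>R. shortest_path_scheme n adj port R \<and> (\<forall>u\<in>{1..n}. (\<forall>v\<in>{1..n} - {u}. R u v \<le> n) \<and>
    (\<forall>v\<in>{1..n} - {u} - {w. adj u w}. (\<exists>w\<in>{1..M}. adj u w \<and> adj w v) \<longrightarrow>
      (\<exists>w\<in>{w. adj u w} \<inter> {1..n} - {u}. w \<le> M \<and> R u w = R u v)))"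
proof -
  define hop where "hop u v =
    (if adj u v then v
     else if \<exists>w\<in>{1..M}. adj u w \<and> adj w v then SOME w. w \<in> {1..M} \<and> adj u w \<and> adj w v
     else SOME w. closer adj u v w)" for u v
  \<comment> \<open>For an unreachable destination \<open>hop\<close> is arbitrary; the default 0
    keeps the entry within the bound n.\<close>
  define R where "R u v = (if closer adj u v (hop u v) then port u (hop u v) else 0)" for u v
  have adj: "u \<noteq> v \<and> u \<in> {1..n} \<and> v \<in> {1..n}" if "adj u v" for u v
    using G that unfolding graph_on_def by blast
  have hop_common: "hop u v \<in> {1..M} \<and> adj u (hop u v) \<and> adj (hop u v) v"
    if "\<not> adj u v" "\<exists>w\<in>{1..M}. adj u w \<and> adj w v" for u v
  proof -
    have "\<exists>w. w \<in> {1..M} \<and> adj u w \<and> adj w v"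
      using that(2) by blast
    from someI_ex[OF this] show ?thesis
      using that by (simp add: hop_def)
  qed
  have hop: "closer adj u v (hop u v)" if "u \<noteq> v" "reachable adj u v" for u v
  proof (cases "adj u v")
    case True
    then show ?thesis using closer_adjacent[of adj u v] that(1) by (simp add: hop_def)
  next
    case False
    show ?thesis
    proof (cases "\<exists>w\<in>{1..M}. adj u w \<and> adj w v")
      case True
      then show ?thesis
        using hop_common[OF False True] closer_common_neighbour[of adj u "hop u v" v] False that(1) by blast
    next
      case no: False
      have "closer adj u v (SOME w. closer adj u v w)"
        using ex_closer[OF that(2,1)] by (rule someI_ex)
      then show ?thesis
        unfolding hop_def if_not_P[OF False] if_not_P[OF no] .
    qed
  qed
  have "shortest_path_scheme n adj port R"
    using G port by (rule shortest_path_schemeI[where hop = hop]) (simp add: hop R_def)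
  moreover have "R u v \<le> n" if "u \<in> {1..n}" for u v
  proof -
    have "{w. adj u w} \<subseteq> {1..n}"
      using adj by blast
    then have "deg adj u \<le> n"
      using card_mono[of "{1..n}" "{w. adj u w}"] by (simp add: Defs.deg_def)
    moreover have "port u (hop u v) \<le> deg adj u" if "closer adj u v (hop u v)"
      using port_le_deg[OF port \<open>u \<in> {1..n}\<close>, of "hop u v"] that by (simp add: closer_def)
    ultimately show ?thesis
      by (auto simp: R_def)
  qed
  moreover have "\<exists>w\<in>{w. adj u w} \<inter> {1..n} - {u}. w \<le> M \<and> R u w = R u v"
    if "v \<noteq> u" "\<not> adj u v" "\<exists>w\<in>{1..M}. adj u w \<and> adj w v" for u v
  proof -
    define w where "w = hop u v"
    have w: "w \<in> {1..M}" "adj u w" "adj w v"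
      using hop_common[OF that(2,3)] by (simp_all add: w_def)
    have "closer adj u v w"
      using closer_common_neighbour[OF w(2,3) that(2)] that(1) by simp
    then have "R u v = port u w"
      by (simp add: R_def w_def)
    \<comment> \<open>Neighbours are reached directly, so the entry for \<open>w\<close> is the port
      towards \<open>w\<close>, which is exactly the entry needed for \<open>v\<close>.\<close>
    moreover have "hop u w = w"
      using w(2) by (simp add: hop_def)
    then have "R u w = port u w"
      using closer_adjacent[of adj u w] w(2) adj[OF w(2)] by (simp add: R_def)
    ultimately show ?thesis
      using w adj[OF w(2)] by (intro bexI[of _ w]) auto
  qed
  ultimately show ?thesis by (intro exI[of _ R]) auto
qed

text \<open>f n is the infimum of the admissible slacks plus 1/(n + 1): the infimum need not be
  attained, but anything above it is admissible by monotonicity.\<close>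

lemma ex_vanishing_slack:
  fixes S :: "nat \<Rightarrow> real \<Rightarrow> bool"
  assumes mono: "\<And>n \<epsilon> \<epsilon>'. S n \<epsilon> \<Longrightarrow> \<epsilon> \<le> \<epsilon>' \<Longrightarrow> S n \<epsilon>'"
    and ex: "\<And>n. \<exists>\<epsilon>\<ge>0. S n \<epsilon>"
    and small: "\<And>\<epsilon>. \<epsilon> > 0 \<Longrightarrow> \<forall>\<^sub>F n in sequentially. S n \<epsilon>"
  shows "\<exists>f. f \<longlonglongrightarrow> 0 \<and> (\<forall>n. S n (f n))"
proof -
  define A where "A n = {\<epsilon>. 0 \<le> \<epsilon> \<and> S n \<epsilon>}" for n
  define f where "f n = Inf (A n) + 1 / (real n + 1)" for n
  have A: "A n \<noteq> {}" "bdd_below (A n)" for n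
    using ex[of n] by (auto simp: A_def intro: bdd_belowI[of _ 0])
  have "S n (f n)" for n
  proof -
    have "Inf (A n) < f n"
      by (simp add: f_def)
    then obtain \<epsilon> where "\<epsilon> \<in> A n" "\<epsilon> < f n"
      using cInf_lessD[OF A(1)] by blast
    then show ?thesis
      using mono[of n \<epsilon> "f n"] by (simp add: A_def)
  qed
  moreover have "f \<longlonglongrightarrow> 0"
  proof (rule tendstoI)
    fix \<epsilon> :: real assume \<epsilon>: "\<epsilon> > 0"
    then have "\<forall>\<^sub>F n in sequentially. 1 / (real n + 1) < \<epsilon> / 2"
      by real_asymp
    moreover have "\<forall>\<^sub>F n in sequentially. S n (\<epsilon> / 2)"
      using \<epsilon> by (intro small) simp
    ultimately show "\<forall>\<^sub>F n in sequentially. dist (f n) 0 < \<epsilon>"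
    proof eventually_elim
      case (elim n)
      have "Inf (A n) \<le> \<epsilon> / 2"
        using elim(2) \<epsilon> by (intro cInf_lower A(2)) (simp add: A_def)
      moreover have "0 \<le> Inf (A n)"
        using A(1) by (intro cInf_greatest) (auto simp: A_def)
      ultimately show ?case
        using elim(1) by (simp add: f_def)
    qed
  qed
  ultimately show ?thesis by blast
qed

theorem theorem6:
  fixes U :: "bool list \<Rightarrow> bool list \<Rightarrow> bool list option" and c :: real
  assumes "universal U" and "c \<ge> 0"
  shows "\<exists>f :: nat \<Rightarrow> real. (f \<longlongrightarrow> 0) sequentially \<and>
    (\<forall>n adj port. n \<ge> 2 \<and> random_graph U n (c * log 2 (real n)) adj \<and> port_assignment n adj port \<longrightarrow>
       (\<exists>R. shortest_path_scheme n adj port R \<and>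
            (\<forall>u\<in>{1..n}. real (local_size U n R u) \<le> (real n / 2) * log 2 (real n) * (1 + f n)) \<and>
            real (\<Sum>u\<in>{1..n}. local_size U n R u) \<le> (real n ^ 2 / 2) * log 2 (real n) * (1 + f n)))"
proof -
  define K where "K = nat \<lceil>c + 3\<rceil>"
  have K: "c + 3 \<le> real K"
    unfolding K_def by linarith
  obtain c' where size: "\<And>n u R S. u \<in> {1..n} \<and> finite S \<and> (\<forall>v\<in>{1..n} - {u}. R u v \<le> n) \<and>
      (\<forall>v\<in>{1..n} - {u} - S. \<exists>w\<in>S \<inter> {1..n} - {u}. w \<le> cover K n \<and> R u w = R u v) \<Longrightarrow>
    real (local_size U n R u) \<le>
      real c' + real n * log 2 (real (cover K n) + 1) + real (card S) * log 2 (real n + 1)"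
    using local_size_le[OF assms(1), of K] by blast
  define L where "L n = real n / 2 * log 2 (real n)" for n
  define S where "S n \<epsilon> \<longleftrightarrow> (\<forall>adj port.
      n \<ge> 2 \<and> random_graph U n (c * log 2 (real n)) adj \<and> port_assignment n adj port \<longrightarrow>
      (\<exists>R. shortest_path_scheme n adj port R \<and>
        (\<forall>u\<in>{1..n}. real (local_size U n R u) \<le> L n * (1 + \<epsilon>))))" for n \<epsilon>
  have L_nonneg: "0 \<le> L n" for n
    by (cases "n = 0") (simp_all add: L_def)
  have "\<exists>f. f \<longlonglongrightarrow> 0 \<and> (\<forall>n. S n (f n))"
  proof (rule ex_vanishing_slack)
    show "S n \<epsilon>'" if "S n \<epsilon>" "\<epsilon> \<le> \<epsilon>'" for n \<epsilon> \<epsilon>'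
    proof -
      have "L n * (1 + \<epsilon>) \<le> L n * (1 + \<epsilon>')"
        using that(2) L_nonneg by (intro mult_left_mono) auto
      then show ?thesis
        using that(1) unfolding S_def by (meson order_trans)
    qed
  next
    fix n
    \<comment> \<open>Crude bound without randomness: every destination is listed, so nothing has to
      be shared. For n < 2 the claim is vacuous and the quotient by \<open>L n\<close> = 0 is
      0.\<close>
    define B where
      "B = real c' + real n * log 2 (real (cover K n) + 1) + real n * log 2 (real n + 1)"
    have "0 \<le> B"
      unfolding B_def by simp
    have "S n (B / L n)"
      unfolding S_def
    proof (intro allI impI)
      fix adj port
      assume *: "n \<ge> 2 \<and> random_graph U n (c * log 2 (real n)) adj \<and> port_assignment n adj port"
      then have "graph_on n adj" "port_assignment n adj port"
        by (simp_all add: random_graph_def)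
      from shortest_path_scheme_small_tables[OF this]
      obtain R where R: "shortest_path_scheme n adj port R" "\<forall>u\<in>{1..n}. \<forall>v\<in>{1..n} - {u}. R u v \<le> n"
        by blast
      have "real (local_size U n R u) \<le> L n * (1 + B / L n)" if "u \<in> {1..n}" for u
      proof -
        have "0 < L n"
          using * by (simp add: L_def)
        have "real (local_size U n R u) \<le>
            real c' + real n * log 2 (real (cover K n) + 1) + real (card {1..n}) * log 2 (real n + 1)"
          by (rule size) (use that R(2) in auto)
        then have "real (local_size U n R u) \<le> B"
          by (simp add: B_def)
        also have "B \<le> L n * (1 + B / L n)"
          using \<open>0 < L n\<close> by (simp add: distrib_left)
        finally show ?thesis .
      qed
      with R(1) show "\<exists>R. shortest_path_scheme n adj port R \<and>
          (\<forall>u\<in>{1..n}. real (local_size U n R u) \<le> L n * (1 + B / L n))"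
        by blast
    qed
    moreover have "0 \<le> B / L n"
      using \<open>0 \<le> B\<close> L_nonneg by simp
    ultimately show "\<exists>\<epsilon>\<ge>0. S n \<epsilon>"
      by blast
  next
    fix \<epsilon> :: real assume \<epsilon>: "\<epsilon> > 0"
    \<comment> \<open>With 1/q \<le> \<epsilon>/4 the listed ports cost about n(1/2 + \<epsilon>/4)
      log n, that is 1 + \<epsilon>/2 times \<open>L n\<close>; the other half of \<epsilon> absorbs
      the n log log n term.\<close>
    define q where "q = nat \<lceil>4 / \<epsilon>\<rceil>"
    have "4 / \<epsilon> \<le> real q"
      unfolding q_def by linarith
    moreover have "0 < 4 / \<epsilon>"
      using \<epsilon> by simp
    ultimately have q0: "0 < real q"
      by linarith
    then have q: "q \<ge> 1" "1 / real q \<le> \<epsilon> / 4"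
      using \<open>4 / \<epsilon> \<le> real q\<close> \<epsilon> by (simp_all add: field_simps)
    define B where "B n = real c' + real n * log 2 (3 * real K * (log 2 (real n) + 1) + 3) +
      real n * (1 / 2 + \<epsilon> / 4) * log 2 (real n + 1)" for n
    have "0 < real K" "0 < 1 / 2 + \<epsilon> / 4"
      using K assms(2) \<epsilon> by linarith+
    then have "(\<lambda>n. B n / L n) \<longlonglongrightarrow> 1 + \<epsilon> / 2"
      unfolding B_def L_def using \<open>0 < real K\<close> \<open>0 < 1 / 2 + \<epsilon> / 4\<close> by real_asymp
    moreover have "1 + \<epsilon> / 2 < 1 + \<epsilon>"
      using \<epsilon> by simp
    ultimately have "\<forall>\<^sub>F n in sequentially. B n / L n < 1 + \<epsilon>"
      by (rule order_tendstoD(2))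
    moreover have "\<forall>\<^sub>F n in sequentially. n \<ge> (2::nat)"
      by (rule eventually_ge_at_top)
    ultimately show "\<forall>\<^sub>F n in sequentially. S n \<epsilon>"
      using random_graph_degree_le[OF assms(1) q(1), of c] random_graph_common_neighbour[OF assms(1) K]
    proof eventually_elim
      case (elim n)
      have "0 < L n"
        using elim(2) by (simp add: L_def)
      then have B_le: "B n \<le> L n * (1 + \<epsilon>)"
        using elim(1) by (simp add: field_simps)
      show ?case
        unfolding S_def
      proof (intro allI impI)
        fix adj port
        assume *: "n \<ge> 2 \<and> random_graph U n (c * log 2 (real n)) adj \<and> port_assignment n adj port"
        then have G: "graph_on n adj" "port_assignment n adj port"
          by (simp_all add: random_graph_def)
        from shortest_path_scheme_small_tables[OF this, of "cover K n"]
        obtain R where R: "shortest_path_scheme n adj port R"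
            "\<And>u v. u \<in> {1..n} \<Longrightarrow> v \<in> {1..n} - {u} \<Longrightarrow> R u v \<le> n"
            "\<And>u v. u \<in> {1..n} \<Longrightarrow> v \<in> {1..n} - {u} - {w. adj u w} \<Longrightarrow>
              \<exists>w\<in>{1..cover K n}. adj u w \<and> adj w v \<Longrightarrow>
              \<exists>w\<in>{w. adj u w} \<inter> {1..n} - {u}. w \<le> cover K n \<and> R u w = R u v"
          by blast
        have "real (local_size U n R u) \<le> L n * (1 + \<epsilon>)" if u: "u \<in> {1..n}" for u
        proof -
          have fin: "finite {w. adj u w}"
            by (rule finite_subset[of _ "{1..n}"]) (use G(1) in \<open>auto simp: graph_on_def\<close>)
          have common: "\<exists>w\<in>{1..cover K n}. adj u w \<and> adj w v" if "v \<in> {1..n} - {u}" for v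
            using elim(4)[rule_format, of adj u v] * u that by simp
          have "real (local_size U n R u) \<le> real c' + real n * log 2 (real (cover K n) + 1) +
              real (card {w. adj u w}) * log 2 (real n + 1)"
          proof (rule size, intro conjI ballI)
            fix v assume v: "v \<in> {1..n} - {u} - {w. adj u w}"
            then show "\<exists>w\<in>{w. adj u w} \<inter> {1..n} - {u}. w \<le> cover K n \<and> R u w = R u v"
              by (intro R(3) u common) simp_all
          qed (fact u fin R(2)[OF u])+
          also have "\<dots> \<le> B n"
            unfolding B_def
          proof (intro add_mono mult_left_mono mult_right_mono order_refl)
            have "real K * real (lg n) \<le> real K * (log 2 (real n) + 1)"
              using lg_bounds(2)[of n] elim(2) by (intro mult_left_mono) auto
            then show "log 2 (real (cover K n) + 1) \<le> log 2 (3 * real K * (log 2 (real n) + 1) + 3)"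
              by (intro log_mono) (simp_all add: cover_def add_pos_nonneg)
            have "2 * q * deg adj u \<le> (q + 2) * n"
              using elim(3)[rule_format, of adj u] * u by simp
            then have "real (2 * q * deg adj u) \<le> real ((q + 2) * n)"
              by (simp only: of_nat_le_iff)
            then have "real (deg adj u) \<le> real n * (1 / 2 + 1 / real q)"
              using q0 by (simp add: field_simps)
            also have "\<dots> \<le> real n * (1 / 2 + \<epsilon> / 4)"
              using q(2) by (intro mult_left_mono) auto
            finally show "real (card {w. adj u w}) \<le> real n * (1 / 2 + \<epsilon> / 4)"
              by (simp add: Defs.deg_def)
          qed auto
          also note B_le
          finally show ?thesis .
        qed
        with R(1) show "\<exists>R. shortest_path_scheme n adj port R \<and>
            (\<forall>u\<in>{1..n}. real (local_size U n R u) \<le> L n * (1 + \<epsilon>))"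
          by blast
      qed
    qed
  qed
  then obtain f where f: "f \<longlonglongrightarrow> 0" "\<And>n. S n (f n)"
    by blast
  have "\<exists>R. shortest_path_scheme n adj port R \<and>
      (\<forall>u\<in>{1..n}. real (local_size U n R u) \<le> (real n / 2) * log 2 (real n) * (1 + f n)) \<and>
      real (\<Sum>u\<in>{1..n}. local_size U n R u) \<le> (real n ^ 2 / 2) * log 2 (real n) * (1 + f n)"
    if *: "n \<ge> 2 \<and> random_graph U n (c * log 2 (real n)) adj \<and> port_assignment n adj port" for n adj port
  proof -
    obtain R where R: "shortest_path_scheme n adj port R"
        "\<And>u. u \<in> {1..n} \<Longrightarrow> real (local_size U n R u) \<le> L n * (1 + f n)"
      using f(2)[of n] * unfolding S_def by blast
    have "real (\<Sum>u\<in>{1..n}. local_size U n R u) \<le> (\<Sum>u\<in>{1..n}. L n * (1 + f n))"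
      unfolding of_nat_sum by (rule sum_mono) (rule R(2))
    also have "\<dots> = (real n ^ 2 / 2) * log 2 (real n) * (1 + f n)"
      by (simp add: L_def power2_eq_square)
    finally show ?thesis
      using R unfolding L_def by blast
  qed
  with f(1) show ?thesis by blast
qed

end
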